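(* Let $m\ge 1$, let $d\le e$ be coprime positive integers, let $(d_s,e_s)$ be the starting vector of $(d,e)$ (so $d,d_s,e,e_s$ fulfil the glueing conditions), and let $k\in\mathbb{N}=\{0,1,2,\dots\}$ and $l\geq 1$. Let $T^0\in\mathcal{T}^m_{d_s+kd,\,e_s+ke}$ and $(T^1,j_1)\in\mathcal{S}_{ld,\,le+1}^m$, where $\mathcal{S}_{ld,le+1}^m$ is formed with respect to this $k$. Moreover, let $j_0$ with $\hat{d}_{j_0}\geq 1$ be a sink of $T^0$ such that $R_{j_0}+R_{j_1}\leq m$. Then the glueing quiver $Q_{j_0,j_1}(T^0,T^1)$ with glueing vertex $j_2$, where $\hat{d}_{j_2}:=\hat{d}_{j_0}+\hat{d}_{j_1}-1$ and all other vertices keep their dimension, is an element of $\mathcal{T}^m_{d_s+(k+l)d,\,e_s+(k+l)e}$.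
   Context: Representations are over $\mathbb{C}$. A quiver is bipartite if its vertex set is $I\cup J$ with every $i\in I$ a source and every $j\in J$ a sink. All bipartite quivers come with a dimension vector $\hat d$; the dimension type is $(\sum_{i\in I}\hat d_i,\sum_{j\in J}\hat d_j)$. For a vertex $q$, $A_q$ is the set of vertices $q'$ with $\hat d_{q'}\ge1$ joined to $q$ by an arrow, and $R_q=|A_q|$. The quiver is $m$-bipartite if $R_q\le m$ for all vertices. Slope of a representation $X$ of dimension type $(d,e)$: $\mu(X)=d/(d+e)$. $X$ is semistable (stable) if $\mu(U)\le\mu(X)$ ($\mu(U)<\mu(X)$) for all proper nonzero subrepresentations $U$. A bipartite quiver (with $\hat d$) is stable if it has a stable representation of dimension $\hat d$. $\mathcal{T}_{d,e}^m$ is the set of all stable $m$-bipartite quivers of dimension type $(d,e)$. For a representation $X$ and a subspace $U=\bigoplus_{i\in I}U_i\subseteq\bigoplus_{i\in I}X_i$, put $d_U=\dim\sum_{i\in I,\ t(\alpha)=i}X_\alpha(U_i)$, where $t(\alpha)$ is the tail of $\alpha$. Glueing: for bipartite quivers $Q,Q'$ with sinks $j,j'$, $Q_{j,j'}(Q,Q')$ is obtained from the disjoint union of $Q$ and $Q'$ by identifying $j$ with $j'$ (the glueing vertex). Glueing conditions for $d,e,d_s,e_s$: (1) $\frac{e+e_s}{d+d_s}d<e+1$ if $d\ne1$; (2) $\frac{e+e_s}{d+d_s}d>e$ if $d\neq1$; (3) $\frac{e_s-1}{d_s}<\frac ed$ if $d\ne 1$ and $(e_s-1)d=ed_s$ if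 $d=1$; (4) $\frac{e+e_s}{d+d_s}d'<\lceil\frac ed d'\rceil$ for all $1\le d'<d$; (5) $\gcd(d+d_s,e+e_s)=1$. The starting vector of $(d,e)$ is the unique coprime vector with $d_s\le d$, $e_s\le e$ satisfying these; explicitly $(0,1)$ if $d=1$, and for $d\ge2$, $d_s$ is the minimal positive integer with $d\mid 1+ed_s$ and $e_s=(1+d_se)/d$. $\mathcal{S}_{ld,le+1}^m$ is the set of pairs of a connected $m$-bipartite quiver (with dimension vector $\hat d$) of dimension type $(ld,le+1)$ and a sink $j$ with $\hat d_j\ge1$ such that: (i) there is a representation $T$ of dimension $\hat d$ such that for every nonzero subspace $U=\bigoplus_iU_i\subseteq \bigoplus_i T_i$ of dimension $d'$ one has $d_U>\frac{(k+l)e+e_s}{(k+l)d+d_s}d'$; (ii) after decreasing the dimension of the sink $j$ by one, the resulting quiver is connected and the corresponding factor representation of $T$ (the quotient by a one-dimensional subspace of $T_j$) is semistable. *)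

theory Defs
  imports
    Complex_Main
    "HOL-Library.Function_Algebras"
    "Graph_Theory.Digraph_Component"
begin

section \<open>Complex vector spaces\<close>

text \<open>
  All vector spaces of representations are taken as finite-dimensional subspaces of the space
  of complex sequences. This is no restriction up to isomorphism.
\<close>

type_synonym cvec = "nat \<Rightarrow> complex"

definition cscale :: "complex \<Rightarrow> cvec \<Rightarrow> cvec" where
  "cscale c v = (\<lambda>n. c * v n)"

interpretation cvec: vector_space cscale
  by unfold_locales (auto simp: cscale_def fun_eq_iff algebra_simps)

text \<open>
  Finite dimensionality has to be demanded separately, because
  \<^term>\<open>cvec.dim W\<close> is \<open>0\<close> for an infinite-dimensional \<open>W\<close>.
\<close>

definition fd_space :: "cvec set \<Rightarrow> bool" where
  "fd_space W \<longleftrightarrow> (\<exists>B. finite B \<and> W = cvec.span B)"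

section \<open>Bipartite quivers with dimension vector\<close>

record ('v, 'a) bip_quiver =
  graph :: "('v, 'a) pre_digraph"
  sources :: "'v set"
  sinks :: "'v set"
  dimv :: "'v \<Rightarrow> nat"

definition bipartite_quiver :: "('v, 'a) bip_quiver \<Rightarrow> bool" where
  "bipartite_quiver Q \<longleftrightarrow>
     fin_digraph (graph Q) \<and>
     verts (graph Q) = sources Q \<union> sinks Q \<and> sources Q \<inter> sinks Q = {} \<and>
     (\<forall>i\<in>sources Q. in_arcs (graph Q) i = {}) \<and>
     (\<forall>j\<in>sinks Q. out_arcs (graph Q) j = {})"

definition dim_type :: "('v, 'a) bip_quiver \<Rightarrow> nat \<times> nat" where
  "dim_type Q = ((\<Sum>i\<in>sources Q. dimv Q i), (\<Sum>j\<in>sinks Q. dimv Q j))"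

definition nbrs :: "('v, 'a) bip_quiver \<Rightarrow> 'v \<Rightarrow> 'v set" where
  "nbrs Q q = {q' \<in> verts (graph Q). dimv Q q' \<ge> 1 \<and>
     ((q, q') \<in> arcs_ends (graph Q) \<or> (q', q) \<in> arcs_ends (graph Q))}"

definition m_bipartite :: "nat \<Rightarrow> ('v, 'a) bip_quiver \<Rightarrow> bool" where
  "m_bipartite m Q \<longleftrightarrow>
     bipartite_quiver Q \<and> (\<forall>q\<in>verts (graph Q). card (nbrs Q q) \<le> m)"

text \<open>
  Vertices of dimension \<open>0\<close> do not count for connectedness, in agreement with the definition of
  \<^const>\<open>nbrs\<close>: lowering the dimension of a vertex from \<open>1\<close> to \<open>0\<close> deletes it.
\<close>

definition connected_quiver :: "('v, 'a) bip_quiver \<Rightarrow> bool" where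
  "connected_quiver Q \<longleftrightarrow>
     Digraph_Component.connected (graph Q \<restriction> {q \<in> verts (graph Q). dimv Q q \<ge> 1})"

section \<open>Representations\<close>

record ('v, 'a) rep =
  space :: "'v \<Rightarrow> cvec set"
  amap :: "'a \<Rightarrow> cvec \<Rightarrow> cvec"

text \<open>
  Only the restriction of \<^term>\<open>amap X a\<close> to the space at the tail of \<open>a\<close> is relevant; any
  linear map between subspaces is the restriction of a linear map on all sequences.
\<close>

definition is_rep :: "('v, 'a) bip_quiver \<Rightarrow> ('v, 'a) rep \<Rightarrow> bool" where
  "is_rep Q X \<longleftrightarrow>
     (\<forall>q\<in>verts (graph Q). fd_space (space X q)) \<and>
     (\<forall>a\<in>arcs (graph Q). Vector_Spaces.linear cscale cscale (amap X a) \<and>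
        amap X a ` space X (tail (graph Q) a) \<subseteq> space X (head (graph Q) a))"

definition has_dimv :: "('v, 'a) bip_quiver \<Rightarrow> ('v, 'a) rep \<Rightarrow> bool" where
  "has_dimv Q X \<longleftrightarrow> (\<forall>q\<in>verts (graph Q). cvec.dim (space X q) = dimv Q q)"

definition slope :: "('v, 'a) bip_quiver \<Rightarrow> ('v \<Rightarrow> cvec set) \<Rightarrow> real" where
  "slope Q W =
     (let d = (\<Sum>i\<in>sources Q. cvec.dim (W i)); e = (\<Sum>j\<in>sinks Q. cvec.dim (W j))
      in real d / (real d + real e))"

definition subrep :: "('v, 'a) bip_quiver \<Rightarrow> ('v, 'a) rep \<Rightarrow> ('v \<Rightarrow> cvec set) \<Rightarrow> bool" where
  "subrep Q X U \<longleftrightarrow>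
     (\<forall>q\<in>verts (graph Q). cvec.subspace (U q) \<and> U q \<subseteq> space X q) \<and>
     (\<forall>a\<in>arcs (graph Q). amap X a ` U (tail (graph Q) a) \<subseteq> U (head (graph Q) a))"

definition proper_nonzero_subrep ::
    "('v, 'a) bip_quiver \<Rightarrow> ('v, 'a) rep \<Rightarrow> ('v \<Rightarrow> cvec set) \<Rightarrow> bool" where
  "proper_nonzero_subrep Q X U \<longleftrightarrow> subrep Q X U \<and>
     (\<exists>q\<in>verts (graph Q). U q \<noteq> space X q) \<and> (\<exists>q\<in>verts (graph Q). U q \<noteq> {0})"

definition semistable_rep :: "('v, 'a) bip_quiver \<Rightarrow> ('v, 'a) rep \<Rightarrow> bool" where
  "semistable_rep Q X \<longleftrightarrow> is_rep Q X \<and>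
     (\<forall>U. proper_nonzero_subrep Q X U \<longrightarrow> slope Q U \<le> slope Q (space X))"

definition stable_rep :: "('v, 'a) bip_quiver \<Rightarrow> ('v, 'a) rep \<Rightarrow> bool" where
  "stable_rep Q X \<longleftrightarrow> is_rep Q X \<and>
     (\<forall>U. proper_nonzero_subrep Q X U \<longrightarrow> slope Q U < slope Q (space X))"

text \<open>
  \<open>Y\<close> is a factor representation \<open>X / K\<close>, up to isomorphism: there is an epimorphism from \<open>X\<close>
  onto \<open>Y\<close> with kernel \<open>K\<close>.
\<close>

definition factor_rep ::
    "('v, 'a) bip_quiver \<Rightarrow> ('v, 'a) rep \<Rightarrow> ('v \<Rightarrow> cvec set) \<Rightarrow> ('v, 'a) rep \<Rightarrow> bool" where
  "factor_rep Q X K Y \<longleftrightarrow> is_rep Q Y \<and> subrep Q X K \<and>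
     (\<exists>\<phi>. (\<forall>q\<in>verts (graph Q). Vector_Spaces.linear cscale cscale (\<phi> q) \<and>
              \<phi> q ` space X q = space Y q \<and> {x \<in> space X q. \<phi> q x = 0} = K q) \<and>
          (\<forall>a\<in>arcs (graph Q). \<forall>x\<in>space X (tail (graph Q) a).
              \<phi> (head (graph Q) a) (amap X a x) = amap Y a (\<phi> (tail (graph Q) a) x)))"

definition source_subspace ::
    "('v, 'a) bip_quiver \<Rightarrow> ('v, 'a) rep \<Rightarrow> ('v \<Rightarrow> cvec set) \<Rightarrow> bool" where
  "source_subspace Q X U \<longleftrightarrow> (\<forall>i\<in>sources Q. cvec.subspace (U i) \<and> U i \<subseteq> space X i)"

text \<open>
  The number \<open>d\<^sub>U\<close>. The sum of all images of the \<open>U\<^sub>i\<close> inside the direct sum of the spaces at the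
  sinks is the direct sum over the sinks \<open>j\<close> of the sums of those images that lie in the space
  at \<open>j\<close>.
\<close>

definition image_dim :: "('v, 'a) bip_quiver \<Rightarrow> ('v, 'a) rep \<Rightarrow> ('v \<Rightarrow> cvec set) \<Rightarrow> nat" where
  "image_dim Q X U =
     (\<Sum>j\<in>sinks Q. cvec.dim (cvec.span
        (\<Union>a\<in>in_arcs (graph Q) j. amap X a ` U (tail (graph Q) a))))"

section \<open>Stable quivers, glueing, and the starting vector\<close>

definition stable_quivers :: "nat \<Rightarrow> nat \<Rightarrow> nat \<Rightarrow> ('v, 'a) bip_quiver set" where
  "stable_quivers m d e =
     {Q. m_bipartite m Q \<and> dim_type Q = (d, e) \<and>
         (\<exists>X. is_rep Q X \<and> has_dimv Q X \<and> stable_rep Q X)}"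

text \<open>
  \<open>glue_vertex j\<^sub>0 j\<^sub>1\<close> sends the vertices of the second quiver into the glued quiver, in which
  the glueing vertex is \<open>Inl j\<^sub>0\<close>.
\<close>

definition glue_vertex :: "'v0 \<Rightarrow> 'v1 \<Rightarrow> 'v1 \<Rightarrow> 'v0 + 'v1" where
  "glue_vertex j0 j1 v = (if v = j1 then Inl j0 else Inr v)"

definition glue_quiver ::
    "('v0, 'a0) bip_quiver \<Rightarrow> 'v0 \<Rightarrow> ('v1, 'a1) bip_quiver \<Rightarrow> 'v1 \<Rightarrow>
     ('v0 + 'v1, 'a0 + 'a1) bip_quiver" where
  "glue_quiver Q0 j0 Q1 j1 =
     \<lparr> graph =
         \<lparr> verts = Inl ` verts (graph Q0) \<union> glue_vertex j0 j1 ` verts (graph Q1),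
           arcs = arcs (graph Q0) <+> arcs (graph Q1),
           tail = case_sum (Inl \<circ> tail (graph Q0)) (glue_vertex j0 j1 \<circ> tail (graph Q1)),
           head = case_sum (Inl \<circ> head (graph Q0)) (glue_vertex j0 j1 \<circ> head (graph Q1)) \<rparr>,
       sources = Inl ` sources Q0 \<union> glue_vertex j0 j1 ` sources Q1,
       sinks = Inl ` sinks Q0 \<union> glue_vertex j0 j1 ` sinks Q1,
       dimv = (case_sum (dimv Q0) (dimv Q1))(Inl j0 := dimv Q0 j0 + dimv Q1 j1 - 1) \<rparr>"

text \<open>
  In the third condition the quotient by \<open>d\<^sub>s\<close> causes no harm for \<open>d\<^sub>s = 0\<close>: the first two
  conditions exclude \<open>d\<^sub>s = 0\<close> if \<open>d \<noteq> 1\<close>.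
\<close>

definition glueing_conditions :: "nat \<Rightarrow> nat \<Rightarrow> nat \<Rightarrow> nat \<Rightarrow> bool" where
  "glueing_conditions d e ds es \<longleftrightarrow>
     (d \<noteq> 1 \<longrightarrow> (real e + real es) / (real d + real ds) * real d < real e + 1) \<and>
     (d \<noteq> 1 \<longrightarrow> (real e + real es) / (real d + real ds) * real d > real e) \<and>
     (d \<noteq> 1 \<longrightarrow> (real es - 1) / real ds < real e / real d) \<and>
     (d = 1 \<longrightarrow> (real es - 1) * real d = real e * real ds) \<and>
     (\<forall>d'. 1 \<le> d' \<and> d' < d \<longrightarrow>
        (real e + real es) / (real d + real ds) * real d' <
          of_int \<lceil>real e / real d * real d'\<rceil>) \<and>
     coprime (d + ds) (e + es)"

definition starting_vector :: "nat \<Rightarrow> nat \<Rightarrow> nat \<Rightarrow> nat \<Rightarrow> bool" where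
  "starting_vector d e ds es \<longleftrightarrow>
     coprime ds es \<and> ds \<le> d \<and> es \<le> e \<and> glueing_conditions d e ds es"

text \<open>The set \<open>\<S>\<close> of pairs of type \<open>(l d, l e + 1)\<close>, formed with respect to \<open>k\<close>.\<close>

definition glueable_pairs ::
    "nat \<Rightarrow> nat \<Rightarrow> nat \<Rightarrow> nat \<Rightarrow> nat \<Rightarrow> nat \<Rightarrow> nat \<Rightarrow> (('v, 'a) bip_quiver \<times> 'v) set" where
  "glueable_pairs m d e ds es k l =
     {(Q, j). m_bipartite m Q \<and> connected_quiver Q \<and> dim_type Q = (l * d, l * e + 1) \<and>
        j \<in> sinks Q \<and> dimv Q j \<ge> 1 \<and>
        (\<exists>T. is_rep Q T \<and> has_dimv Q T \<and>
           (\<forall>U. source_subspace Q T U \<and> (\<exists>i\<in>sources Q. U i \<noteq> {0}) \<longrightarrow>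
              real (image_dim Q T U) >
                real ((k + l) * e + es) / real ((k + l) * d + ds) *
                real (\<Sum>i\<in>sources Q. cvec.dim (U i))) \<and>
           connected_quiver (Q\<lparr>dimv := (dimv Q)(j := dimv Q j - 1)\<rparr>) \<and>
           (\<exists>L Y. cvec.subspace L \<and> L \<subseteq> space T j \<and> cvec.dim L = 1 \<and>
              factor_rep Q T ((\<lambda>_. {0})(j := L)) Y \<and>
              semistable_rep (Q\<lparr>dimv := (dimv Q)(j := dimv Q j - 1)\<rparr>) Y))}"

end

theory Submission
  imports Defs
begin

text \<open>
  Write \<open>(d\<^sub>0, e\<^sub>0)\<close> for the type \<open>(d\<^sub>s + k d, e\<^sub>s + k e)\<close> of the first quiver. Let \<open>X\<close> be a stable
  representation of it, let \<open>T\<close> be the representation of the second quiver that comes with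
  membership in \<open>\<S>\<close>, and let \<open>Y = T / L\<close> be its semistable factor, of type \<open>(l d, l e)\<close>.
  Identify the line \<open>L\<close> in the space of \<open>T\<close> at \<open>j\<^sub>1\<close> with any line in the space of \<open>X\<close> at \<open>j\<^sub>0\<close>.
  The result is a representation \<open>M\<close> of the glued quiver, of the wanted dimension vector, which
  contains \<open>X\<close> and \<open>T\<close> and which is an extension \<open>0 \<rightarrow> X \<rightarrow> M \<rightarrow> Y \<rightarrow> 0\<close>. It is shown that \<open>M\<close> is
  stable.

  A subrepresentation of type \<open>(p, q)\<close> of a representation of type \<open>(p\<^sub>0, q\<^sub>0)\<close> has smaller slope
  iff \<open>p q\<^sub>0 < p\<^sub>0 q\<close>. Let \<open>U\<close> be a proper nonzero subrepresentation of \<open>M\<close>, let \<open>(a, b)\<close> be the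
  type of \<open>U \<inter> X\<close> and \<open>(a'', b'')\<close> the type of the image of \<open>U\<close> in \<open>Y\<close>. The type of \<open>U\<close> is the sum
  of these two.

  \<^item> If \<open>U \<inter> X = 0\<close>, all sources in the support of \<open>U\<close> belong to \<open>T\<close>. Since \<open>T\<close> embeds into \<open>M\<close>,
    the sinks of \<open>U\<close> contain the images under \<open>T\<close> of the source spaces, and the condition on the
    numbers \<open>d\<^sub>U\<close> in the definition of \<open>\<S>\<close> is the wanted inequality.
  \<^item> If \<open>U \<inter> X\<close> is a proper nonzero subrepresentation of \<open>X\<close>, stability of \<open>X\<close> gives
    \<open>a e\<^sub>0 < d\<^sub>0 b\<close>. The numbers are integers and the glueing conditions force
    \<open>e\<^sub>0 d - e d\<^sub>0 = 1\<close>, so that also \<open>a e < d b\<close>; this slack outweighs the loss in \<open>Y\<close>.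
  \<^item> If \<open>U\<close> contains \<open>X\<close>, the loss in \<open>Y\<close> is smaller than for \<open>Y\<close> itself, because \<open>U \<noteq> M\<close>.

  The second and third case are the lemmas \<open>slope_inequality_proper\<close> and
  \<open>slope_inequality_full\<close>; the determinant is computed in \<open>starting_vector_det\<close>, and the three
  cases are put together in \<open>stable_M\<close>.
\<close>

section \<open>Dimensions of finite-dimensional spaces of sequences\<close>

lemma fd_space_imp_subspace: "fd_space V \<Longrightarrow> cvec.subspace V"
  by (auto simp: fd_space_def)

lemma subspace_of_fd_space_has_finite_basis:
  assumes "cvec.subspace V" "V \<subseteq> W" "fd_space W"
  obtains B where "finite B" "cvec.independent B" "V = cvec.span B"
proof -
  obtain A where A: "finite A" "W = cvec.span A" using assms by (auto simp: fd_space_def)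
  obtain B where B: "B \<subseteq> V" "cvec.independent B" "V \<subseteq> cvec.span B"
    using cvec.maximal_independent_subset[of V] by blast
  have "finite B" using cvec.independent_span_bound[OF A(1) B(2)] B(1) A assms by blast
  moreover have "cvec.span B \<subseteq> V" using B assms by (simp add: cvec.span_minimal)
  ultimately show ?thesis using B that by blast
qed

lemma fd_space_subset: "cvec.subspace V \<Longrightarrow> V \<subseteq> W \<Longrightarrow> fd_space W \<Longrightarrow> fd_space V"
  by (metis fd_space_def subspace_of_fd_space_has_finite_basis)

lemma fd_space_image:
  assumes "Vector_Spaces.linear cscale cscale f" "fd_space V"
  shows "fd_space (f ` V)"
proof -
  interpret f: Vector_Spaces.linear cscale cscale f by fact
  obtain B where "finite B" "V = cvec.span B" using assms by (auto simp: fd_space_def)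
  then show ?thesis using f.span_image[of B] by (auto simp: fd_space_def)
qed

lemma dim_mono_fd_space:
  assumes "V \<subseteq> W" "fd_space W"
  shows "cvec.dim V \<le> cvec.dim W"
proof -
  obtain B where B: "finite B" "cvec.independent B" "W = cvec.span B"
    using subspace_of_fd_space_has_finite_basis[OF fd_space_imp_subspace subset_refl] assms by metis
  then have "cvec.dim V \<le> card B" using assms by (intro cvec.dim_le_card) auto
  then show ?thesis using B by (simp add: cvec.dim_eq_card_independent)
qed

lemma dim_zero_space [simp]: "cvec.dim {0} = 0"
  using cvec.dim_span[of "{}"] cvec.dim_eq_card_independent[of "{}"]
  by (simp add: cvec.independent_empty)

text \<open>
  The space of all sequences is infinite-dimensional, so the rank theorem is proved for the
  restriction of \<open>f\<close> to \<open>V\<close>: a basis \<open>B\<close> of the kernel extends to a basis \<open>C\<close> of \<open>V\<close>, and \<open>f\<close> maps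
  \<open>C - B\<close> bijectively onto a basis of the image.
\<close>

lemma rank_nullity:
  assumes lin: "Vector_Spaces.linear cscale cscale f" and V: "fd_space V"
  shows "cvec.dim V = cvec.dim {x \<in> V. f x = 0} + cvec.dim (f ` V)"
proof -
  interpret f: Vector_Spaces.linear cscale cscale f by fact
  let ?K = "{x \<in> V. f x = 0}"
  have K: "cvec.subspace ?K"
    using fd_space_imp_subspace[OF V] by (auto simp: cvec.subspace_def f.add f.scale f.zero)
  obtain B where B: "cvec.independent B" "?K = cvec.span B"
    using subspace_of_fd_space_has_finite_basis[OF K _ V] by auto
  then have "B \<subseteq> V" using cvec.span_superset[of B] by blast
  then obtain C where C: "B \<subseteq> C" "C \<subseteq> V" "cvec.independent C" "V \<subseteq> cvec.span C"
    using cvec.maximal_independent_subset_extend[OF _ B(1)] by blast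
  have VC: "V = cvec.span C" using C V by (simp add: cvec.span_minimal fd_space_imp_subspace subset_antisym)
  have "finite C"
    using V C cvec.independent_span_bound[of _ C] by (auto simp: fd_space_def)
  have zero: "x = 0" if x: "x \<in> cvec.span (C - B)" "f x = 0" for x
  proof -
    have "x \<in> V" using x cvec.span_mono[of "C - B" C] VC by blast
    then have "x \<in> cvec.span B" using B x by blast
    have xC: "x \<in> cvec.span C" using \<open>x \<in> V\<close> VC by simp
    \<comment> \<open>The coordinates of \<open>x\<close> with respect to \<open>C\<close> are supported in \<open>B\<close> and in \<open>C - B\<close>, hence vanish.\<close>
    have "cvec.representation C x = cvec.representation B x"
      "cvec.representation C x = cvec.representation (C - B) x"
      using \<open>x \<in> cvec.span B\<close> x(1) C by (auto intro!: cvec.representation_extend)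
    then have "cvec.representation C x b = 0" for b
      using cvec.representation_ne_zero[of B x b] cvec.representation_ne_zero[of "C - B" x b] by auto
    then show ?thesis
      using cvec.sum_nonzero_representation_eq[OF C(3) xC] by simp
  qed
  have inj: "inj_on f (cvec.span (C - B))"
    using zero by (auto simp: inj_on_def) (metis cvec.span_diff eq_iff_diff_eq_0 f.diff)
  have ind: "cvec.independent (f ` (C - B))"
    using inj cvec.independent_mono[OF C(3)] by (intro f.independent_injective_image) auto
  have "f ` V = cvec.span (f ` C)" by (simp add: VC f.span_image)
  also have "\<dots> = cvec.span (f ` (C - B))"
  proof
    have "f ` C \<subseteq> insert 0 (f ` (C - B))" using B cvec.span_superset[of B] by fastforce
    then show "cvec.span (f ` C) \<subseteq> cvec.span (f ` (C - B))"
      by (metis cvec.span_insert_0 cvec.span_mono)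
  qed (intro cvec.span_mono image_mono Diff_subset)
  finally have "cvec.dim (f ` V) = card (f ` (C - B))"
    using ind by (simp add: cvec.dim_eq_card_independent)
  also have "\<dots> = card (C - B)"
    using inj by (meson card_image cvec.span_superset inj_on_subset)
  finally show ?thesis
    using B C VC \<open>finite C\<close>
    by (simp add: cvec.dim_eq_card_independent card_Diff_subset finite_subset card_mono)
qed

lemma dim_inj_image:
  assumes "Vector_Spaces.linear cscale cscale f" "fd_space V" "\<And>x. x \<in> V \<Longrightarrow> f x = 0 \<Longrightarrow> x = 0"
  shows "cvec.dim (f ` V) = cvec.dim V"
proof -
  interpret f: Vector_Spaces.linear cscale cscale f by fact
  have "{x \<in> V. f x = 0} = {0}"
    using assms cvec.subspace_0[OF fd_space_imp_subspace[OF assms(2)]] by auto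
  then show ?thesis using rank_nullity[OF assms(1,2)] by simp
qed

lemma subspace_eq_of_dim_eq:
  assumes "cvec.subspace V" "V \<subseteq> W" "fd_space W" "cvec.dim V = cvec.dim W"
  shows "V = W"
proof -
  obtain B where B: "finite B" "cvec.independent B" "V = cvec.span B"
    using subspace_of_fd_space_has_finite_basis[OF assms(1-3)] .
  then have "B \<subseteq> W" using assms(2) cvec.span_superset by blast
  then obtain C where C: "B \<subseteq> C" "C \<subseteq> W" "cvec.independent C" "W \<subseteq> cvec.span C"
    using cvec.maximal_independent_subset_extend[OF _ B(2)] by blast
  have "finite C"
    using assms C cvec.independent_span_bound[of _ C] by (auto simp: fd_space_def)
  moreover have "card C = card B"
    using assms(4) B C by (metis cvec.basis_card_eq_dim cvec.dim_span_eq_card_independent)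
  ultimately have "B = C" using C(1) by (simp add: card_subset_eq)
  then show ?thesis using B C assms(2) by blast
qed

section \<open>Stability in terms of dimension types\<close>

definition src_dim :: "('v, 'a) bip_quiver \<Rightarrow> ('v \<Rightarrow> cvec set) \<Rightarrow> nat" where
  "src_dim Q U = (\<Sum>i\<in>sources Q. cvec.dim (U i))"

definition snk_dim :: "('v, 'a) bip_quiver \<Rightarrow> ('v \<Rightarrow> cvec set) \<Rightarrow> nat" where
  "snk_dim Q U = (\<Sum>j\<in>sinks Q. cvec.dim (U j))"

lemma bipartite_quiver_finite:
  assumes "bipartite_quiver Q"
  shows "finite (sources Q)" "finite (sinks Q)" "finite (verts (graph Q))"
proof -
  have "fin_digraph (graph Q)" using assms by (simp add: bipartite_quiver_def)
  then show "finite (verts (graph Q))" by (rule fin_digraph.finite_verts)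
  then show "finite (sources Q)" "finite (sinks Q)"
    using assms by (auto simp: bipartite_quiver_def)
qed

lemma src_dim_plus_snk_dim:
  assumes "bipartite_quiver Q"
  shows "src_dim Q U + snk_dim Q U = (\<Sum>q\<in>verts (graph Q). cvec.dim (U q))"
proof -
  have "verts (graph Q) = sources Q \<union> sinks Q" "sources Q \<inter> sinks Q = {}"
    using assms by (auto simp: bipartite_quiver_def)
  then show ?thesis
    using bipartite_quiver_finite[OF assms] by (simp add: src_dim_def snk_dim_def sum.union_disjoint)
qed

lemma dim_type_of_rep:
  assumes "bipartite_quiver Q" "has_dimv Q X"
  shows "dim_type Q = (src_dim Q (space X), snk_dim Q (space X))"
  using assms by (auto simp: dim_type_def src_dim_def snk_dim_def has_dimv_def bipartite_quiver_def
      intro!: sum.cong)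

lemma subrep_fd_space:
  assumes "is_rep Q X" "subrep Q X U" "q \<in> verts (graph Q)"
  shows "fd_space (U q)"
  using assms fd_space_subset[of "U q" "space X q"] by (auto simp: is_rep_def subrep_def)

lemma subrep_dim_le:
  assumes "is_rep Q X" "subrep Q X U" "q \<in> verts (graph Q)"
  shows "cvec.dim (U q) \<le> cvec.dim (space X q)"
  using assms by (auto simp: is_rep_def subrep_def intro!: dim_mono_fd_space)

lemma dim_zero_iff:
  assumes "fd_space V"
  shows "cvec.dim V = 0 \<longleftrightarrow> V = {0}"
proof
  assume "cvec.dim V = 0"
  moreover have "{0} \<subseteq> V" using cvec.subspace_0[OF fd_space_imp_subspace[OF assms]] by simp
  ultimately show "V = {0}"
    using subspace_eq_of_dim_eq[of "{0}" V] assms cvec.subspace_single_0 by simp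
qed simp

lemma subrep_nonzero_iff:
  assumes "bipartite_quiver Q" "is_rep Q X" "subrep Q X U"
  shows "(\<exists>q\<in>verts (graph Q). U q \<noteq> {0}) \<longleftrightarrow> 0 < src_dim Q U + snk_dim Q U"
proof -
  have "(\<exists>q\<in>verts (graph Q). U q \<noteq> {0}) \<longleftrightarrow> (\<exists>q\<in>verts (graph Q). cvec.dim (U q) \<noteq> 0)"
    by (intro bex_cong refl) (simp add: dim_zero_iff[OF subrep_fd_space[OF assms(2,3)]])
  also have "\<dots> \<longleftrightarrow> (\<Sum>q\<in>verts (graph Q). cvec.dim (U q)) \<noteq> 0"
    using bipartite_quiver_finite[OF assms(1)] by simp
  finally show ?thesis by (simp add: src_dim_plus_snk_dim[OF assms(1)])
qed

lemma subrep_proper_iff: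
  assumes "bipartite_quiver Q" "is_rep Q X" "subrep Q X U"
  shows "(\<exists>q\<in>verts (graph Q). U q \<noteq> space X q) \<longleftrightarrow>
    src_dim Q U + snk_dim Q U < src_dim Q (space X) + snk_dim Q (space X)"
proof -
  have *: "U q = space X q \<longleftrightarrow> cvec.dim (U q) = cvec.dim (space X q)" if "q \<in> verts (graph Q)" for q
    using assms(2,3) that subspace_eq_of_dim_eq[of "U q" "space X q"]
    by (auto simp: is_rep_def subrep_def)
  have le: "cvec.dim (U q) \<le> cvec.dim (space X q)" if "q \<in> verts (graph Q)" for q
    using subrep_dim_le[OF assms(2,3) that] .
  show ?thesis
  proof
    assume "\<exists>q\<in>verts (graph Q). U q \<noteq> space X q"
    then obtain q where "q \<in> verts (graph Q)" "cvec.dim (U q) < cvec.dim (space X q)"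
      using * le by (meson le_neq_implies_less)
    then show "src_dim Q U + snk_dim Q U < src_dim Q (space X) + snk_dim Q (space X)"
      unfolding src_dim_plus_snk_dim[OF assms(1)]
      using le bipartite_quiver_finite(3)[OF assms(1)] by (intro sum_strict_mono_ex1) blast+
  next
    assume "src_dim Q U + snk_dim Q U < src_dim Q (space X) + snk_dim Q (space X)"
    then show "\<exists>q\<in>verts (graph Q). U q \<noteq> space X q"
      unfolding src_dim_plus_snk_dim[OF assms(1)] by (metis (no_types, lifting) less_irrefl sum.cong)
  qed
qed

text \<open>
  Clearing denominators, \<open>p / (p + q) < p\<^sub>0 / (p\<^sub>0 + q\<^sub>0)\<close> becomes \<open>p q\<^sub>0 < p\<^sub>0 q\<close>; this turns
  stability into inequalities between natural numbers.
\<close>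

lemma slope_less_iff:
  assumes "0 < src_dim Q U + snk_dim Q U" "0 < src_dim Q W + snk_dim Q W"
  shows "slope Q U < slope Q W \<longleftrightarrow> src_dim Q U * snk_dim Q W < src_dim Q W * snk_dim Q U"
proof -
  have cross: "a / s < c / t \<longleftrightarrow> a * t < c * s" if "0 < s" "0 < t" for a c s t :: real
    using that by (simp add: field_simps)
  have "slope Q X = real (src_dim Q X) / (real (src_dim Q X) + real (snk_dim Q X))" for X
    by (simp add: slope_def src_dim_def snk_dim_def)
  moreover have "0 < real (src_dim Q X) + real (snk_dim Q X)"
    if "0 < src_dim Q X + snk_dim Q X" for X
    using that by linarith
  ultimately have "slope Q U < slope Q W \<longleftrightarrow>
      real (src_dim Q U) * (real (src_dim Q W) + real (snk_dim Q W))
      < real (src_dim Q W) * (real (src_dim Q U) + real (snk_dim Q U))"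
    using assms by (simp only: cross)
  also have "\<dots> \<longleftrightarrow> real (src_dim Q U * snk_dim Q W) < real (src_dim Q W * snk_dim Q U)"
    by (simp add: algebra_simps)
  finally show ?thesis by (simp only: of_nat_less_iff)
qed

lemma proper_nonzero_subrep_iff:
  assumes "bipartite_quiver Q" "is_rep Q X"
  shows "proper_nonzero_subrep Q X U \<longleftrightarrow> subrep Q X U \<and> 0 < src_dim Q U + snk_dim Q U \<and>
    src_dim Q U + snk_dim Q U < src_dim Q (space X) + snk_dim Q (space X)"
  using subrep_nonzero_iff[OF assms, of U] subrep_proper_iff[OF assms, of U]
  by (auto simp: proper_nonzero_subrep_def)

lemma stable_rep_iff:
  assumes "bipartite_quiver Q"
  shows "stable_rep Q X \<longleftrightarrow> is_rep Q X \<and> (\<forall>U. subrep Q X U \<and> 0 < src_dim Q U + snk_dim Q U \<and>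
    src_dim Q U + snk_dim Q U < src_dim Q (space X) + snk_dim Q (space X) \<longrightarrow>
    src_dim Q U * snk_dim Q (space X) < src_dim Q (space X) * snk_dim Q U)"
proof (cases "is_rep Q X")
  case True
  have slope: "slope Q U < slope Q (space X) \<longleftrightarrow>
      src_dim Q U * snk_dim Q (space X) < src_dim Q (space X) * snk_dim Q U"
    if "0 < src_dim Q U + snk_dim Q U"
      "src_dim Q U + snk_dim Q U < src_dim Q (space X) + snk_dim Q (space X)" for U
    using slope_less_iff[of Q U "space X"] that by linarith
  show ?thesis
    unfolding stable_rep_def proper_nonzero_subrep_iff[OF assms True] by (simp add: slope del: add_gr_0)
qed (simp add: stable_rep_def)

lemma subrep_dims_le:
  assumes "bipartite_quiver Q" "is_rep Q X" "subrep Q X U"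
  shows "src_dim Q U \<le> src_dim Q (space X)" "snk_dim Q U \<le> snk_dim Q (space X)"
  using subrep_dim_le[OF assms(2,3)] assms(1)
  by (auto simp: src_dim_def snk_dim_def bipartite_quiver_def intro!: sum_mono)

text \<open>
  The definition speaks of proper nonzero subrepresentations; for the zero and for the full one
  both sides agree.
\<close>

lemma semistable_rep_imp:
  assumes "bipartite_quiver Q" "semistable_rep Q X" "subrep Q X U"
  shows "src_dim Q U * snk_dim Q (space X) \<le> src_dim Q (space X) * snk_dim Q U"
proof -
  have X: "is_rep Q X" using assms by (simp add: semistable_rep_def)
  note le = subrep_dims_le[OF assms(1) X assms(3)]
  consider "src_dim Q U + snk_dim Q U = 0"
    | "src_dim Q U + snk_dim Q U = src_dim Q (space X) + snk_dim Q (space X)"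
    | "0 < src_dim Q U + snk_dim Q U"
      "src_dim Q U + snk_dim Q U < src_dim Q (space X) + snk_dim Q (space X)"
    using le by linarith
  then show ?thesis
  proof cases
    case 2
    then have "src_dim Q U = src_dim Q (space X)" "snk_dim Q U = snk_dim Q (space X)"
      using le by linarith+
    then show ?thesis by simp
  next
    case 3
    then have "\<not> slope Q (space X) < slope Q U"
      using assms(2,3) proper_nonzero_subrep_iff[OF assms(1) X, of U]
      by (force simp: semistable_rep_def)
    then show ?thesis
      using 3 slope_less_iff[of Q "space X" U] by (simp add: mult.commute not_less del: add_gr_0)
  qed simp
qed

lemma bipartite_quiver_arcs:
  assumes "bipartite_quiver Q" "a \<in> arcs (graph Q)"
  shows "tail (graph Q) a \<in> sources Q" "head (graph Q) a \<in> sinks Q"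
proof -
  have "fin_digraph (graph Q)" using assms by (simp add: bipartite_quiver_def)
  then interpret fin_digraph "graph Q" .
  have "tail (graph Q) a \<in> sources Q \<union> sinks Q" "head (graph Q) a \<in> sources Q \<union> sinks Q"
    using assms tail_in_verts head_in_verts by (auto simp: bipartite_quiver_def)
  then show "tail (graph Q) a \<in> sources Q" "head (graph Q) a \<in> sinks Q"
    using assms by (auto simp: bipartite_quiver_def in_arcs_def out_arcs_def)
qed

section \<open>Arithmetic of the glueing conditions\<close>

text \<open>
  For \<open>d = 1\<close> the third condition is the claim. Otherwise let \<open>x = e\<^sub>s d - e d\<^sub>s\<close>. The second and
  third condition give \<open>0 < x < d\<close>, where the first one rules out \<open>d\<^sub>s = 0\<close>. Take \<open>d' < d\<close> with \<open>e d' + 1 = d q\<close>: there the rounding up in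
  the fourth condition gains only \<open>1 / d\<close>, and the condition reads \<open>x d' < d + d\<^sub>s\<close>. Modulo \<open>d\<close>
  the numbers \<open>x d'\<close> and \<open>d\<^sub>s\<close> agree, hence they are equal. It follows that \<open>e\<^sub>s = x q\<close>, so \<open>x\<close>
  divides both \<open>d\<^sub>s\<close> and \<open>e\<^sub>s\<close>, which are coprime.
\<close>

lemma starting_vector_det:
  assumes "0 < d" "coprime d e" "starting_vector d e ds es"
  shows "es * d = e * ds + 1"
proof (cases "d = 1")
  case True
  have "real es - 1 = real e * real ds"
    using assms True by (auto simp: starting_vector_def glueing_conditions_def)
  then have "real es = real (e * ds + 1)" by simp
  then have "es = e * ds + 1" by (simp only: of_nat_eq_iff)
  then show ?thesis using True by simp
next
  case False
  then have d2: "2 \<le> d" using assms by simp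
  have g1: "(real e + real es) / (real d + real ds) * real d < real e + 1"
    and g2: "(real e + real es) / (real d + real ds) * real d > real e"
    and g3: "(real es - 1) / real ds < real e / real d"
    and g4: "\<forall>d'. 1 \<le> d' \<and> d' < d \<longrightarrow>
        (real e + real es) / (real d + real ds) * real d' < of_int \<lceil>real e / real d * real d'\<rceil>"
    and cop: "coprime ds es" and le: "ds \<le> d" "es \<le> e"
    using False assms(3) by (auto simp: starting_vector_def glueing_conditions_def)
  define x where "x = int es * int d - int e * int ds"
  have "real e * (real d + real ds) < (real e + real es) * real d"
    using g2 d2 by (simp add: field_simps)
  then have "real (e * ds) < real (es * d)" by (simp add: algebra_simps)
  then have "e * ds < es * d" by (simp only: of_nat_less_iff)
  then have x0: "x > 0" by (simp add: x_def flip: of_nat_mult)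
  have "ds \<noteq> 0"
  proof
    assume "ds = 0"
    then have "es = 1" using cop by simp
    then show False using g1 \<open>ds = 0\<close> d2 by simp
  qed
  have "(real es - 1) * real d < real e * real ds"
    using g3 d2 \<open>ds \<noteq> 0\<close> by (simp add: field_simps)
  then have "real (es * d) < real (e * ds + d)" by (simp add: algebra_simps)
  then have "es * d < e * ds + d" by (simp only: of_nat_less_iff)
  then have "int (es * d) < int (e * ds + d)" by (simp only: of_nat_less_iff)
  then have "x < int d" by (simp add: x_def)
  have "ds \<noteq> d"
  proof
    assume "ds = d"
    then have "int d dvd x" by (simp add: x_def)
    then show False using x0 \<open>x < int d\<close> zdvd_not_zless by blast
  qed
  then have dsd: "ds < d" using le by simp
  \<comment> \<open>\<open>d'\<close> is the inverse of \<open>- e\<close> modulo \<open>d\<close>.\<close>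
  obtain d' q where d': "1 \<le> d'" "d' < d" and q: "e * d' + 1 = d * q"
  proof -
    obtain u v where uv: "d * u = e * v + 1"
      using bezout_nat[of d e] assms(1,2) by (auto simp: coprime_iff_gcd_eq_1 gcd.commute)
    have "(e * (v mod d) + 1) mod d = (e * v + 1) mod d"
      by (metis mod_add_left_eq mod_mult_right_eq)
    also have "\<dots> = 0" by (metis mod_mult_self1_is_0 uv)
    finally obtain q where q: "e * (v mod d) + 1 = d * q" by (auto simp: mod_eq_0_iff_dvd dvd_def)
    have "v mod d \<noteq> 0"
    proof
      assume "v mod d = 0"
      then show False using q d2 by simp
    qed
    then show ?thesis using that[of "v mod d" q] q assms(1) by simp
  qed
  have q_int: "int e * int d' + 1 = int d * int q"
    using q by (metis of_nat_1 of_nat_add of_nat_mult)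
  have "real e * real d' + 1 = real d * real q"
    using q by (metis of_nat_1 of_nat_add of_nat_mult)
  then have "real e / real d * real d' = real q - 1 / real d"
    using d2 by (simp add: field_simps)
  then have "\<lceil>real e / real d * real d'\<rceil> = int q"
    using d2 by (intro ceiling_unique) auto
  then have "(real e + real es) / (real d + real ds) * real d' < real q"
    using g4 d' by (metis of_int_of_nat_eq)
  then have "real ((e + es) * d') < real (q * (d + ds))"
    using d2 by (simp add: field_simps)
  then have "(e + es) * d' < q * (d + ds)" by (simp only: of_nat_less_iff)
  then have "d * ((e + es) * d') < d * (q * (d + ds))" using assms(1) by simp
  then have "int (d * ((e + es) * d')) < int (d * (q * (d + ds)))" by (simp only: of_nat_less_iff)
  moreover have "int (d * (q * (d + ds))) = (int e * int d' + 1) * (int d + int ds)"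
    unfolding q_int by simp
  ultimately have ub: "x * int d' < int d + int ds"
    by (simp add: x_def algebra_simps)
  have t: "x * int d' - int ds = int d * (int es * int d' - int q * int ds)"
    unfolding x_def using q_int by algebra
  define t where "t = int es * int d' - int q * int ds"
  have "int d * t < int d * 1" using ub t by (simp add: t_def)
  moreover have "int d * (- 1) < int d * t"
  proof -
    have "0 < x * int d'" using x0 d' by simp
    then show ?thesis using t dsd unfolding t_def by linarith
  qed
  ultimately have "t = 0" using assms(1) unfolding mult_less_cancel_left by auto
  then have xd': "x * int d' = int ds" using t by (simp add: t_def)
  have "int es * int d = x + int e * (x * int d')" using xd' by (simp add: x_def)
  also have "\<dots> = x * (int e * int d' + 1)" by (simp add: algebra_simps)
  also have "\<dots> = x * int q * int d" unfolding q_int by simp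
  finally have "int es * int d = x * int q * int d" .
  then have "int es = x * int q" using assms(1) by simp
  then have "x dvd int es" "x dvd int ds" using xd' by (metis dvd_triv_left)+
  moreover have "coprime (int ds) (int es)" using cop by simp
  ultimately have "x dvd 1" using coprime_common_divisor by blast
  then have "x = 1" using x0 by simp
  then have "int (es * d) = int (e * ds + 1)" by (simp add: x_def)
  then show ?thesis by (simp only: of_nat_eq_iff)
qed

text \<open>
  In both of the following lemmas \<open>(a'', b'')\<close> is the type of a subrepresentation of a semistable
  representation of type \<open>(l d, l e)\<close>. Multiplied by \<open>d\<close>, the difference of the two sides is here
  \<open>(l d - a'') + y (d\<^sub>0 + l d)\<close> with \<open>y = d b'' - a'' e \<ge> 0\<close>. It vanishes only if \<open>a'' = l d\<close> and
  \<open>y = 0\<close>, that is, for the full type \<open>(l d, l e)\<close>.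
\<close>

lemma slope_inequality_full:
  fixes a'' b'' :: nat
  assumes det: "e0 * d = e * d0 + (1::nat)" and "a'' \<le> l * d" "a'' * e \<le> d * b''"
    and "a'' + b'' < l * d + l * e" and "0 < d"
  shows "(d0 + a'') * (e0 + l * e) < (d0 + l * d) * (e0 + b'')"
proof -
  define y where "y = int d * int b'' - int a'' * int e"
  have "a'' * e \<le> d * b''" by fact
  then have y0: "y \<ge> 0" by (simp add: y_def flip: of_nat_mult)
  have det': "int e0 * int d = int e * int d0 + 1"
    using det by (metis of_nat_1 of_nat_add of_nat_mult)
  let ?diff = "(int d0 + int l * int d) * (int e0 + int b'') - (int d0 + int a'') * (int e0 + int l * int e)"
  have "int d * ?diff = (int l * int d - int a'') + y * (int d0 + int l * int d)"
    using det' unfolding y_def by algebra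
  moreover have "0 < (int l * int d - int a'') + y * (int d0 + int l * int d)"
  proof (cases "a'' = l * d")
    case True
    then have "b'' < l * e" using assms by simp
    then have "d * b'' < d * (l * e)" using \<open>0 < d\<close> by simp
    moreover have "d * (l * e) = a'' * e" using True by simp
    ultimately have False using assms(3) by linarith
    then show ?thesis ..
  next
    case False
    then have "a'' < l * d" using assms by simp
    then have "0 < int l * int d - int a''" by (simp flip: of_nat_mult)
    then show ?thesis using y0 by (simp add: add_pos_nonneg)
  qed
  ultimately have "0 < int d * ?diff" by presburger
  then have "0 < ?diff" by (rule zero_less_mult_pos) (use \<open>0 < d\<close> in simp)
  then have "int ((d0 + a'') * (e0 + l * e)) < int ((d0 + l * d) * (e0 + b''))" by simp
  then show ?thesis by (simp only: of_nat_less_iff)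
qed

text \<open>
  Put \<open>w = d\<^sub>0 b - a e\<^sub>0\<close> and \<open>z = d b - a e\<close>. The determinant condition gives \<open>w d + a = z d\<^sub>0\<close>, so
  \<open>w > 0\<close> implies \<open>z > 0\<close>. Integrality sharpens both to \<open>w \<ge> 1\<close> and \<open>z \<ge> 1\<close>, and then
  \<open>w + l z\<close> exceeds \<open>l\<close>, which bounds the loss caused by \<open>(a'', b'')\<close>. A determinant larger
  than \<open>1\<close> would enlarge that loss, but not the bounds on \<open>w\<close> and \<open>z\<close>.
\<close>

lemma slope_inequality_proper:
  fixes a b a'' b'' :: nat
  assumes det: "e0 * d = e * d0 + (1::nat)" and "a'' \<le> l * d" "a'' * e \<le> d * b''"
    and "a * e0 < d0 * b" and "0 < d"
  shows "(a + a'') * (e0 + l * e) < (d0 + l * d) * (b + b'')"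
proof -
  define y where "y = int d * int b'' - int a'' * int e"
  define w where "w = int d0 * int b - int a * int e0"
  define z where "z = int d * int b - int a * int e"
  have y0: "y \<ge> 0" using assms(3) by (simp add: y_def flip: of_nat_mult)
  have w1: "w \<ge> 1" using assms(4) by (simp add: w_def int_one_le_iff_zero_less flip: of_nat_mult)
  have det': "int e0 * int d = int e * int d0 + 1"
    using det by (metis of_nat_1 of_nat_add of_nat_mult)
  have "w * int d + int a = z * int d0" using det' unfolding w_def z_def by algebra
  moreover have "0 < w * int d + int a" using w1 \<open>0 < d\<close> by (simp add: add_pos_nonneg)
  ultimately have z1: "z \<ge> 1" by (simp add: zero_less_mult_iff)
  let ?diff = "(int d0 + int l * int d) * (int b + int b'') - (int a + int a'') * (int e0 + int l * int e)"
  have "int d * ?diff = int d * w + int l * int d * (z - 1) + (int l * int d - int a'')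
      + y * (int d0 + int l * int d)"
    using det' unfolding y_def w_def z_def by algebra
  moreover have "0 < int d * w" "0 \<le> int l * int d * (z - 1)" "0 \<le> y * (int d0 + int l * int d)"
    using w1 z1 y0 \<open>0 < d\<close> by simp_all
  moreover have "0 \<le> int l * int d - int a''" using assms(2) by (simp flip: of_nat_mult)
  ultimately have "0 < int d * ?diff" by linarith
  then have "0 < ?diff" by (rule zero_less_mult_pos) (use \<open>0 < d\<close> in simp)
  then have "int ((a + a'') * (e0 + l * e)) < int ((d0 + l * d) * (b + b''))" by simp
  then show ?thesis by (simp only: of_nat_less_iff)
qed

section \<open>The glued quiver\<close>

lemma arcs_ends_iff:
  "(p, q) \<in> arcs_ends D \<longleftrightarrow> (\<exists>a\<in>arcs D. tail D a = p \<and> head D a = q)"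
  by (auto simp: arcs_ends_def arc_to_ends_def)

locale glueing =
  fixes Q0 :: "('v0, 'a0) bip_quiver" and j0 :: 'v0
    and Q1 :: "('v1, 'a1) bip_quiver" and j1 :: 'v1
  assumes bip0: "bipartite_quiver Q0" and bip1: "bipartite_quiver Q1"
    and j0: "j0 \<in> sinks Q0" and j1: "j1 \<in> sinks Q1"
begin

abbreviation "G \<equiv> glue_quiver Q0 j0 Q1 j1"

lemma j_notin_sources: "j0 \<notin> sources Q0" "j1 \<notin> sources Q1"
  using bip0 bip1 j0 j1 by (auto simp: bipartite_quiver_def)

lemma j_in_verts: "j0 \<in> verts (graph Q0)" "j1 \<in> verts (graph Q1)"
  using bip0 bip1 j0 j1 by (auto simp: bipartite_quiver_def)

lemma sources_G: "sources G = sources Q0 <+> sources Q1"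
  using j_notin_sources by (auto simp: glue_quiver_def glue_vertex_def)

lemma sinks_G: "sinks G = sinks Q0 <+> (sinks Q1 - {j1})"
  using j0 by (auto simp: glue_quiver_def glue_vertex_def)

lemma verts_G: "verts (graph G) = verts (graph Q0) <+> (verts (graph Q1) - {j1})"
  using j_in_verts by (auto simp: glue_quiver_def glue_vertex_def)

lemma arcs_G: "arcs (graph G) = arcs (graph Q0) <+> arcs (graph Q1)"
  by (simp add: glue_quiver_def)

lemma ends_Inl [simp]:
  "tail (graph G) (Inl a) = Inl (tail (graph Q0) a)" "head (graph G) (Inl a) = Inl (head (graph Q0) a)"
  by (simp_all add: glue_quiver_def)

lemma head_Inr [simp]: "head (graph G) (Inr a) = glue_vertex j0 j1 (head (graph Q1) a)"
  by (simp add: glue_quiver_def)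

lemma tail_Inr [simp]:
  assumes "a \<in> arcs (graph Q1)"
  shows "tail (graph G) (Inr a) = Inr (tail (graph Q1) a)"
proof -
  have "tail (graph Q1) a \<noteq> j1" using bipartite_quiver_arcs(1)[OF bip1 assms] j_notin_sources by auto
  then show ?thesis by (simp add: glue_quiver_def glue_vertex_def)
qed

lemma bipartite_G: "bipartite_quiver G"
  unfolding bipartite_quiver_def
proof (intro conjI ballI)
  have fin: "finite (verts (graph Q0))" "finite (verts (graph Q1))"
    using bipartite_quiver_finite bip0 bip1 by blast+
  have "fin_digraph (graph Q0)" "fin_digraph (graph Q1)"
    using bip0 bip1 by (auto simp: bipartite_quiver_def)
  then have fina: "finite (arcs (graph Q0))" "finite (arcs (graph Q1))"
    by (auto intro: fin_digraph.finite_arcs)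
  have V: "verts (graph Q0) = sources Q0 \<union> sinks Q0" "verts (graph Q1) = sources Q1 \<union> sinks Q1"
    "sources Q0 \<inter> sinks Q0 = {}" "sources Q1 \<inter> sinks Q1 = {}"
    using bip0 bip1 by (auto simp: bipartite_quiver_def)
  show "verts (graph G) = sources G \<union> sinks G"
    using V j_notin_sources by (auto simp: verts_G sources_G sinks_G)
  show "sources G \<inter> sinks G = {}"
    using V by (auto simp: sources_G sinks_G)
  have tl: "tail (graph G) a \<in> sources G" if "a \<in> arcs (graph G)" for a
    using that bipartite_quiver_arcs[OF bip0] bipartite_quiver_arcs[OF bip1]
    by (auto simp: sources_G arcs_G)
  have hd: "head (graph G) a \<in> sinks G" if "a \<in> arcs (graph G)" for a
    using that bipartite_quiver_arcs[OF bip0] bipartite_quiver_arcs[OF bip1] j0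
    by (auto simp: sinks_G arcs_G glue_vertex_def)
  show "in_arcs (graph G) i = {}" if "i \<in> sources G" for i
    using that hd \<open>sources G \<inter> sinks G = {}\<close> by (auto simp: in_arcs_def)
  show "out_arcs (graph G) j = {}" if "j \<in> sinks G" for j
    using that tl \<open>sources G \<inter> sinks G = {}\<close> by (auto simp: out_arcs_def)
  show "fin_digraph (graph G)"
  proof
    show "finite (verts (graph G))" "finite (arcs (graph G))"
      using fin fina by (simp_all add: verts_G arcs_G)
  qed (use tl hd \<open>verts (graph G) = sources G \<union> sinks G\<close> in blast)+
qed

lemma src_dim_G:
  "src_dim G U = (\<Sum>i\<in>sources Q0. cvec.dim (U (Inl i))) + (\<Sum>i\<in>sources Q1. cvec.dim (U (Inr i)))"
  using bipartite_quiver_finite[OF bip0] bipartite_quiver_finite[OF bip1]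
  by (simp add: src_dim_def sources_G sum.Plus)

lemma snk_dim_G:
  "snk_dim G U = cvec.dim (U (Inl j0)) + (\<Sum>j\<in>sinks Q0 - {j0}. cvec.dim (U (Inl j)))
    + (\<Sum>j\<in>sinks Q1 - {j1}. cvec.dim (U (Inr j)))"
  using bipartite_quiver_finite[OF bip0] bipartite_quiver_finite[OF bip1]
  by (simp add: snk_dim_def sinks_G sum.Plus sum.remove[OF _ j0])

lemma dimv_G [simp]:
  "dimv G (Inl q) = (if q = j0 then dimv Q0 j0 + dimv Q1 j1 - 1 else dimv Q0 q)"
  "dimv G (Inr q') = dimv Q1 q'"
  by (simp_all add: glue_quiver_def)

text \<open>
  Only the glueing vertex gains neighbours. Positivity of both dimensions at the glueing vertex
  guarantees that wherever it counts as a neighbour in the glued quiver, it did so before.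
\<close>

lemma m_bipartite_G:
  assumes m: "m_bipartite m Q0" "m_bipartite m Q1"
    and pos: "1 \<le> dimv Q0 j0" "1 \<le> dimv Q1 j1"
    and R: "card (nbrs Q0 j0) + card (nbrs Q1 j1) \<le> m"
  shows "m_bipartite m G"
  unfolding m_bipartite_def
proof (intro conjI ballI bipartite_G)
  fix q assume q: "q \<in> verts (graph G)"
  have fin: "finite (nbrs Q0 p)" "finite (nbrs Q1 p')" for p p'
    using bipartite_quiver_finite[OF bip0] bipartite_quiver_finite[OF bip1] by (auto simp: nbrs_def)
  have verts0: "tail (graph Q0) a \<in> verts (graph Q0) \<and> head (graph Q0) a \<in> verts (graph Q0)"
    if "a \<in> arcs (graph Q0)" for a
    using bipartite_quiver_arcs[OF bip0 that] bip0 by (simp add: bipartite_quiver_def)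
  have verts1: "tail (graph Q1) a \<in> verts (graph Q1) \<and> head (graph Q1) a \<in> verts (graph Q1)"
    if "a \<in> arcs (graph Q1)" for a
    using bipartite_quiver_arcs[OF bip1 that] bip1 by (simp add: bipartite_quiver_def)
  have src1: "tail (graph Q1) a \<noteq> j1" if "a \<in> arcs (graph Q1)" for a
    using bipartite_quiver_arcs[OF bip1 that] j_notin_sources by auto
  have src0: "tail (graph Q0) a \<noteq> j0" if "a \<in> arcs (graph Q0)" for a
    using bipartite_quiver_arcs[OF bip0 that] j_notin_sources by auto
  consider (glue) "q = Inl j0" | (left) p where "q = Inl p" "p \<noteq> j0" "p \<in> verts (graph Q0)"
    | (right) p where "q = Inr p" "p \<noteq> j1" "p \<in> verts (graph Q1)"
    using q by (auto simp: verts_G)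
  then show "card (nbrs G q) \<le> m"
  proof cases
    case glue
    have "nbrs G (Inl j0) \<subseteq> Inl ` nbrs Q0 j0 \<union> Inr ` nbrs Q1 j1"
      using verts0 verts1 src0 src1
      by (fastforce simp: nbrs_def arcs_ends_iff arcs_G glue_vertex_def split: if_splits)
    then have "card (nbrs G (Inl j0)) \<le> card (Inl ` nbrs Q0 j0 \<union> Inr ` nbrs Q1 j1)"
      using fin by (intro card_mono) auto
    also have "\<dots> \<le> card (nbrs Q0 j0) + card (nbrs Q1 j1)"
      by (intro card_Un_le[THEN order_trans] add_mono card_image_le fin)
    finally show ?thesis using R glue by simp
  next
    case left
    have "nbrs G (Inl p) \<subseteq> Inl ` nbrs Q0 p"
      using verts0 verts1 src0 src1 left pos
      by (fastforce simp: nbrs_def arcs_ends_iff arcs_G glue_vertex_def split: if_splits)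
    then have "card (nbrs G (Inl p)) \<le> card (nbrs Q0 p)"
      using fin by (meson card_image_le card_mono finite_imageI order_trans)
    also have "\<dots> \<le> m" using m left by (simp add: m_bipartite_def)
    finally show ?thesis using left by simp
  next
    case right
    have "nbrs G (Inr p) \<subseteq> glue_vertex j0 j1 ` nbrs Q1 p"
      using verts0 verts1 src0 src1 right pos
      by (fastforce simp: nbrs_def arcs_ends_iff arcs_G glue_vertex_def image_iff split: if_splits)
    then have "card (nbrs G (Inr p)) \<le> card (nbrs Q1 p)"
      using fin by (meson card_image_le card_mono finite_imageI order_trans)
    also have "\<dots> \<le> m" using m right by (simp add: m_bipartite_def)
    finally show ?thesis using right by simp
  qed
qed

end

section \<open>Direct sums of spaces of sequences\<close>

text \<open>
  Interleaving identifies \<^typ>\<open>cvec\<close> with the direct sum of two copies of itself. The copies sit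
  on the even and on the odd positions; \<open>evens\<close> and \<open>odds\<close> are the two projections.
\<close>

definition on_evens :: "cvec \<Rightarrow> cvec" where
  "on_evens v = (\<lambda>n. if even n then v (n div 2) else 0)"

definition on_odds :: "cvec \<Rightarrow> cvec" where
  "on_odds v = (\<lambda>n. if odd n then v (n div 2) else 0)"

definition evens :: "cvec \<Rightarrow> cvec" where
  "evens v = (\<lambda>n. v (2 * n))"

definition odds :: "cvec \<Rightarrow> cvec" where
  "odds v = (\<lambda>n. v (2 * n + 1))"

lemma linear_cvec_iff:
  "Vector_Spaces.linear cscale cscale f \<longleftrightarrow>
    (\<forall>x y. f (x + y) = f x + f y) \<and> (\<forall>c x. f (cscale c x) = cscale c (f x))"
  by (simp add: Vector_Spaces.linear_iff cvec.vector_space_axioms)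

lemma linear_interleave:
  "Vector_Spaces.linear cscale cscale on_evens" "Vector_Spaces.linear cscale cscale on_odds"
  "Vector_Spaces.linear cscale cscale evens" "Vector_Spaces.linear cscale cscale odds"
  by (auto simp: linear_cvec_iff on_evens_def on_odds_def evens_def odds_def cscale_def fun_eq_iff)

lemma interleave_simps [simp]:
  "evens (on_evens v) = v" "evens (on_odds v) = 0" "odds (on_evens v) = 0" "odds (on_odds v) = v"
  "evens (v + w) = evens v + evens w" "odds (v + w) = odds v + odds w"
  "evens 0 = 0" "odds 0 = 0" "on_evens 0 = 0" "on_odds 0 = 0"
  by (auto simp: on_evens_def on_odds_def evens_def odds_def fun_eq_iff)

lemma interleave_decompose: "on_evens (evens w) + on_odds (odds w) = w"
  by (auto simp: on_evens_def on_odds_def evens_def odds_def fun_eq_iff)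

definition direct_sum :: "cvec set \<Rightarrow> cvec set \<Rightarrow> cvec set" where
  "direct_sum V W = {w. evens w \<in> V \<and> odds w \<in> W}"

lemma fd_space_direct_sum:
  assumes "fd_space V" "fd_space W"
  shows "fd_space (direct_sum V W)"
proof -
  obtain A B where AB: "finite A" "on_evens ` V = cvec.span A" "finite B" "on_odds ` W = cvec.span B"
    using fd_space_image[OF linear_interleave(1) assms(1)] fd_space_image[OF linear_interleave(2) assms(2)]
    by (auto simp: fd_space_def)
  have "direct_sum V W = {x + y |x y. x \<in> on_evens ` V \<and> y \<in> on_odds ` W}" (is "?l = ?r")
  proof
    show "?l \<subseteq> ?r"
    proof
      fix w assume "w \<in> direct_sum V W"
      then have "on_evens (evens w) \<in> on_evens ` V" "on_odds (odds w) \<in> on_odds ` W"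
        by (auto simp: direct_sum_def)
      then show "w \<in> ?r" using interleave_decompose[of w] by (metis (mono_tags, lifting) mem_Collect_eq)
    qed
    show "?r \<subseteq> ?l" by (auto simp: direct_sum_def)
  qed
  also have "\<dots> = cvec.span (A \<union> B)" by (simp add: AB cvec.span_Un)
  finally show ?thesis using AB by (auto simp: fd_space_def)
qed

text \<open>
  The projection of \<open>U\<close> to the second summand has as its kernel the intersection of \<open>U\<close> with the
  first.
\<close>

lemma dim_subspace_direct_sum:
  assumes "fd_space U" "U \<subseteq> direct_sum V W"
  shows "cvec.dim U = cvec.dim {x \<in> V. on_evens x \<in> U} + cvec.dim (odds ` U)"
proof -
  have K: "{w \<in> U. odds w = 0} = on_evens ` {x \<in> V. on_evens x \<in> U}" (is "?K = on_evens ` ?X")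
  proof
    have "w = on_evens (evens w) \<and> evens w \<in> ?X" if "w \<in> ?K" for w
      using that assms(2) interleave_decompose[of w] by (auto simp: direct_sum_def)
    then show "?K \<subseteq> on_evens ` ?X" by blast
  qed auto
  have "cvec.subspace ?K"
    using fd_space_imp_subspace[OF assms(1)] linear_interleave(4)
    by (auto simp: cvec.subspace_def linear_cvec_iff)
  then have "fd_space ?K" by (rule fd_space_subset[OF _ _ assms(1)]) auto
  then have "fd_space (evens ` ?K)" by (intro fd_space_image linear_interleave)
  moreover have "evens ` ?K = ?X" unfolding K by (simp add: image_image)
  ultimately have "fd_space ?X" by simp
  then have "cvec.dim (on_evens ` ?X) = cvec.dim ?X"
    by (intro dim_inj_image linear_interleave) (metis interleave_simps(1,7))+
  then show ?thesis using rank_nullity[OF linear_interleave(4) assms(1)] K by simp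
qed

lemma dim_direct_sum:
  assumes "fd_space V" "fd_space W"
  shows "cvec.dim (direct_sum V W) = cvec.dim V + cvec.dim W"
proof -
  have 0: "0 \<in> V" "0 \<in> W" using assms fd_space_imp_subspace cvec.subspace_0 by blast+
  have "odds ` direct_sum V W = W"
  proof
    show "W \<subseteq> odds ` direct_sum V W"
    proof
      fix w assume "w \<in> W"
      then show "w \<in> odds ` direct_sum V W"
        using 0 by (intro image_eqI[of _ _ "on_odds w"]) (simp_all add: direct_sum_def)
    qed
  qed (auto simp: direct_sum_def)
  moreover have "{x \<in> V. on_evens x \<in> direct_sum V W} = V" using 0 by (auto simp: direct_sum_def)
  ultimately show ?thesis
    using dim_subspace_direct_sum[OF fd_space_direct_sum[OF assms] subset_refl] by simp
qed

section \<open>The glued representation\<close>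

text \<open>
  Here \<open>\<phi>\<close> is the projection of \<open>T\<close> onto \<open>Y = T / L\<close>. The \<open>n\<close>-th coordinate is a linear form
  that does not vanish on the line \<open>L\<close>, and \<open>u\<close> spans the line with which \<open>L\<close> is identified.
\<close>

locale glued_rep = glueing Q0 j0 Q1 j1
  for Q0 :: "('v0, 'a0) bip_quiver" and j0 :: 'v0
    and Q1 :: "('v1, 'a1) bip_quiver" and j1 :: 'v1 +
  fixes X :: "('v0, 'a0) rep" and T Y :: "('v1, 'a1) rep"
    and \<phi> :: "'v1 \<Rightarrow> cvec \<Rightarrow> cvec" and L :: "cvec set" and u :: cvec and n :: nat
  assumes X: "is_rep Q0 X" and T: "is_rep Q1 T" and Y: "is_rep Q1 Y"
    and u: "u \<in> space X j0" "u \<noteq> 0"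
    and lin: "\<And>q. q \<in> verts (graph Q1) \<Longrightarrow> Vector_Spaces.linear cscale cscale (\<phi> q)"
    and onto: "\<And>q. q \<in> verts (graph Q1) \<Longrightarrow> \<phi> q ` space T q = space Y q"
    and ker: "\<And>q. q \<in> verts (graph Q1) \<Longrightarrow> {x \<in> space T q. \<phi> q x = 0} = (if q = j1 then L else {0})"
    and comm: "\<And>a x. a \<in> arcs (graph Q1) \<Longrightarrow> x \<in> space T (tail (graph Q1) a) \<Longrightarrow>
      \<phi> (head (graph Q1) a) (amap T a x) = amap Y a (\<phi> (tail (graph Q1) a) x)"
    and dim_L: "cvec.dim L = 1"
    and n: "\<And>x. x \<in> L \<Longrightarrow> x n = 0 \<Longrightarrow> x = 0"
begin

text \<open>
  The space at the glueing vertex should be the pushout of the spaces of \<open>X\<close> and \<open>T\<close> along the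
  common line. It is modelled as the direct sum of the spaces of \<open>X\<close> and \<open>Y\<close>; \<open>attach\<close> is the
  resulting embedding of the space of \<open>T\<close> at \<open>j1\<close>, and it sends \<open>L\<close> onto the line of \<open>u\<close>.
\<close>

definition attach :: "cvec \<Rightarrow> cvec" where
  "attach t = on_evens (cscale (t n) u) + on_odds (\<phi> j1 t)"

definition M :: "('v0 + 'v1, 'a0 + 'a1) rep" where
  "M = \<lparr> space = case_sum ((space X)(j0 := direct_sum (space X j0) (space Y j1))) (space T),
         amap = case_sum
           (\<lambda>a. if head (graph Q0) a = j0 then on_evens \<circ> amap X a else amap X a)
           (\<lambda>a. if head (graph Q1) a = j1 then attach \<circ> amap T a else amap T a) \<rparr>"

lemma space_M:
  "space M (Inl q) = (if q = j0 then direct_sum (space X j0) (space Y j1) else space X q)"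
  "space M (Inr q') = space T q'"
  by (simp_all add: M_def)

lemma amap_M:
  "amap M (Inl a) = (if head (graph Q0) a = j0 then on_evens \<circ> amap X a else amap X a)"
  "amap M (Inr a') = (if head (graph Q1) a' = j1 then attach \<circ> amap T a' else amap T a')"
  by (simp_all add: M_def)

lemma linear_attach: "Vector_Spaces.linear cscale cscale attach"
proof -
  have "Vector_Spaces.linear cscale cscale (\<phi> j1)" using lin j_in_verts by simp
  then show ?thesis
    using linear_interleave(1,2)
    by (simp add: linear_cvec_iff attach_def cvec.scale_left_distrib cvec.scale_right_distrib)
      (simp add: cscale_def)
qed

lemma odds_attach [simp]: "odds (attach t) = \<phi> j1 t"
  by (simp add: attach_def)

lemma evens_attach: "evens (attach t) = cscale (t n) u"
  by (simp add: attach_def)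

text \<open>
  The kernel of \<open>\<phi> j1\<close> is \<open>L\<close>, on which the first component is injective. This is why \<open>T\<close>, and
  not only \<open>Y\<close>, is visible inside \<open>M\<close>.
\<close>

lemma attach_inj:
  assumes "t \<in> space T j1" "attach t = 0"
  shows "t = 0"
proof -
  have "\<phi> j1 t = 0" "cscale (t n) u = 0"
    using odds_attach[of t] evens_attach[of t] assms(2) by simp_all
  then have "t \<in> L" "t n = 0" using ker[OF j_in_verts(2)] assms(1) u by auto
  then show ?thesis using n by blast
qed

lemma fd_X: "q \<in> verts (graph Q0) \<Longrightarrow> fd_space (space X q)"
  and fd_T: "q' \<in> verts (graph Q1) \<Longrightarrow> fd_space (space T q')"
  and fd_Y: "q' \<in> verts (graph Q1) \<Longrightarrow> fd_space (space Y q')"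
  using X T Y by (auto simp: is_rep_def)

lemma attach_in_direct_sum:
  assumes "t \<in> space T j1"
  shows "attach t \<in> direct_sum (space X j0) (space Y j1)"
  using assms onto[OF j_in_verts(2)] u fd_space_imp_subspace[OF fd_X[OF j_in_verts(1)]]
  by (auto simp: direct_sum_def evens_attach cvec.subspace_scale)

lemma fd_space_M:
  assumes "q \<in> verts (graph G)"
  shows "fd_space (space M q)"
  using assms j_in_verts fd_space_direct_sum[OF fd_X[of j0] fd_Y[of j1]]
  by (auto simp: verts_G space_M fd_X fd_T)

lemma linear_comp:
  "Vector_Spaces.linear cscale cscale f \<Longrightarrow> Vector_Spaces.linear cscale cscale g \<Longrightarrow>
   Vector_Spaces.linear cscale cscale (g \<circ> f)"
  by (simp add: linear_cvec_iff)

lemma is_rep_M: "is_rep G M"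
  unfolding is_rep_def
proof (intro conjI ballI fd_space_M)
  fix a assume "a \<in> arcs (graph G)"
  then consider (left) b where "a = Inl b" "b \<in> arcs (graph Q0)" | (right) b where "a = Inr b" "b \<in> arcs (graph Q1)"
    by (auto simp: arcs_G)
  then show "Vector_Spaces.linear cscale cscale (amap M a)"
    using X T linear_attach linear_interleave(1) linear_comp by cases (auto simp: amap_M is_rep_def)
  from \<open>a \<in> arcs (graph G)\<close>
  consider (left) b where "a = Inl b" "b \<in> arcs (graph Q0)" | (right) b where "a = Inr b" "b \<in> arcs (graph Q1)"
    by (auto simp: arcs_G)
  then show "amap M a ` space M (tail (graph G) a) \<subseteq> space M (head (graph G) a)"
  proof cases
    case left
    have "tail (graph Q0) b \<noteq> j0"
      using bipartite_quiver_arcs[OF bip0 left(2)] j_notin_sources by auto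
    moreover have "amap X b ` space X (tail (graph Q0) b) \<subseteq> space X (head (graph Q0) b)"
      using X left by (simp add: is_rep_def)
    moreover have "0 \<in> space Y j1"
      using fd_Y[OF j_in_verts(2)] fd_space_imp_subspace cvec.subspace_0 by blast
    ultimately show ?thesis by (auto simp: left amap_M space_M direct_sum_def)
  next
    case right
    have "amap T b ` space T (tail (graph Q1) b) \<subseteq> space T (head (graph Q1) b)"
      using T right by (simp add: is_rep_def)
    then show ?thesis
      using right attach_in_direct_sum by (auto simp: amap_M space_M glue_vertex_def)
  qed
qed

text \<open>
  For a subrepresentation \<open>U\<close> of \<open>M\<close>, the following are \<open>U \<inter> X\<close>, as a subrepresentation of \<open>X\<close>,
  and the image of \<open>U\<close> in \<open>Y\<close>.
\<close>

definition sub_part :: "('v0 + 'v1 \<Rightarrow> cvec set) \<Rightarrow> 'v0 \<Rightarrow> cvec set" where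
  "sub_part U q = (if q = j0 then {x \<in> space X j0. on_evens x \<in> U (Inl j0)} else U (Inl q))"

definition quot_part :: "('v0 + 'v1 \<Rightarrow> cvec set) \<Rightarrow> 'v1 \<Rightarrow> cvec set" where
  "quot_part U q = (if q = j1 then odds ` U (Inl j0) else \<phi> q ` U (Inr q))"

context
  fixes U assumes U: "subrep G M U"
begin

lemma subspace_U:
  shows "q \<in> verts (graph Q0) \<Longrightarrow> cvec.subspace (U (Inl q)) \<and> U (Inl q) \<subseteq> space M (Inl q)"
    and "q' \<in> verts (graph Q1) \<Longrightarrow> q' \<noteq> j1 \<Longrightarrow> cvec.subspace (U (Inr q')) \<and> U (Inr q') \<subseteq> space T q'"
proof -
  have *: "cvec.subspace (U p) \<and> U p \<subseteq> space M p" if "p \<in> verts (graph G)" for p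
    using U that by (simp add: subrep_def)
  show "q \<in> verts (graph Q0) \<Longrightarrow> cvec.subspace (U (Inl q)) \<and> U (Inl q) \<subseteq> space M (Inl q)"
    using *[of "Inl q"] by (auto simp: verts_G)
  show "q' \<in> verts (graph Q1) \<Longrightarrow> q' \<noteq> j1 \<Longrightarrow> cvec.subspace (U (Inr q')) \<and> U (Inr q') \<subseteq> space T q'"
    using *[of "Inr q'"] by (auto simp: verts_G space_M)
qed

lemma amap_U:
  shows "a \<in> arcs (graph Q0) \<Longrightarrow> x \<in> U (Inl (tail (graph Q0) a)) \<Longrightarrow>
      amap M (Inl a) x \<in> U (Inl (head (graph Q0) a))"
    and "a' \<in> arcs (graph Q1) \<Longrightarrow> x \<in> U (Inr (tail (graph Q1) a')) \<Longrightarrow>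
      amap M (Inr a') x \<in> U (glue_vertex j0 j1 (head (graph Q1) a'))"
proof -
  have *: "amap M b ` U (tail (graph G) b) \<subseteq> U (head (graph G) b)" if "b \<in> arcs (graph G)" for b
    using U that by (simp add: subrep_def)
  show "a \<in> arcs (graph Q0) \<Longrightarrow> x \<in> U (Inl (tail (graph Q0) a)) \<Longrightarrow>
      amap M (Inl a) x \<in> U (Inl (head (graph Q0) a))"
    using *[of "Inl a"] by (auto simp: arcs_G)
  show "a' \<in> arcs (graph Q1) \<Longrightarrow> x \<in> U (Inr (tail (graph Q1) a')) \<Longrightarrow>
      amap M (Inr a') x \<in> U (glue_vertex j0 j1 (head (graph Q1) a'))"
    using *[of "Inr a'"] by (auto simp: arcs_G)
qed

lemma subrep_sub_part: "subrep Q0 X (sub_part U)"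
  unfolding subrep_def
proof (intro conjI ballI)
  fix q assume q: "q \<in> verts (graph Q0)"
  show "cvec.subspace (sub_part U q)"
    using subspace_U(1)[OF q] fd_space_imp_subspace[OF fd_X[OF q]] linear_interleave(1)
    by (auto simp: sub_part_def cvec.subspace_def linear_cvec_iff)
  show "sub_part U q \<subseteq> space X q"
    using subspace_U(1)[OF q] by (auto simp: sub_part_def space_M)
next
  fix a assume a: "a \<in> arcs (graph Q0)"
  note ends = bipartite_quiver_arcs[OF bip0 a]
  have tj: "tail (graph Q0) a \<noteq> j0" using ends j_notin_sources by auto
  have tv: "tail (graph Q0) a \<in> verts (graph Q0)" using ends bip0 by (simp add: bipartite_quiver_def)
  have "amap X a ` space X (tail (graph Q0) a) \<subseteq> space X (head (graph Q0) a)"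
    using X a by (simp add: is_rep_def)
  then have "amap X a x \<in> space X (head (graph Q0) a)" if "x \<in> U (Inl (tail (graph Q0) a))" for x
    using that subspace_U(1)[OF tv] tj by (auto simp: space_M)
  then show "amap X a ` sub_part U (tail (graph Q0) a) \<subseteq> sub_part U (head (graph Q0) a)"
    using amap_U(1)[OF a] tj by (auto simp: sub_part_def amap_M split: if_splits)
qed

lemma subrep_quot_part: "subrep Q1 Y (quot_part U)"
  unfolding subrep_def
proof (intro conjI ballI)
  fix q assume q: "q \<in> verts (graph Q1)"
  have "cvec.subspace (f ` V)" if "Vector_Spaces.linear cscale cscale f" "cvec.subspace V" for f V
    using that by (intro module_hom.subspace_image[of cscale cscale]) (simp_all add: linear_iff_module_hom)
  then show "cvec.subspace (quot_part U q)"
    using subspace_U(1)[OF j_in_verts(1)] subspace_U(2)[OF q] lin[OF q] linear_interleave(4)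
    by (simp add: quot_part_def)
  show "quot_part U q \<subseteq> space Y q"
    using subspace_U(1)[OF j_in_verts(1)] subspace_U(2)[OF q] onto[OF q]
    by (auto simp: quot_part_def space_M direct_sum_def)
next
  fix a assume a: "a \<in> arcs (graph Q1)"
  note ends = bipartite_quiver_arcs[OF bip1 a]
  have tj: "tail (graph Q1) a \<noteq> j1" using ends j_notin_sources by auto
  have tv: "tail (graph Q1) a \<in> verts (graph Q1)" using ends bip1 by (simp add: bipartite_quiver_def)
  show "amap Y a ` quot_part U (tail (graph Q1) a) \<subseteq> quot_part U (head (graph Q1) a)"
  proof
    fix y assume "y \<in> amap Y a ` quot_part U (tail (graph Q1) a)"
    then obtain x where x: "x \<in> U (Inr (tail (graph Q1) a))"
      and y: "y = amap Y a (\<phi> (tail (graph Q1) a) x)"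
      using tj by (auto simp: quot_part_def)
    have "x \<in> space T (tail (graph Q1) a)" using x subspace_U(2)[OF tv tj] by auto
    then have y': "y = \<phi> (head (graph Q1) a) (amap T a x)" using comm[OF a] y by simp
    show "y \<in> quot_part U (head (graph Q1) a)"
    proof (cases "head (graph Q1) a = j1")
      case True
      then have "attach (amap T a x) \<in> U (Inl j0)"
        using amap_U(2)[OF a x] by (simp add: amap_M glue_vertex_def)
      then have "odds (attach (amap T a x)) \<in> odds ` U (Inl j0)" by (rule imageI)
      then show ?thesis using True y' by (simp add: quot_part_def)
    next
      case False
      then show ?thesis
        using amap_U(2)[OF a x] y' by (simp add: amap_M glue_vertex_def quot_part_def)
    qed
  qed
qed

lemma dim_quot_part:
  assumes "q \<in> verts (graph Q1)" "q \<noteq> j1"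
  shows "cvec.dim (quot_part U q) = cvec.dim (U (Inr q))"
proof -
  have "fd_space (U (Inr q))"
    using subspace_U(2)[OF assms] fd_T[OF assms(1)] fd_space_subset by blast
  moreover have "x = 0" if "x \<in> U (Inr q)" "\<phi> q x = 0" for x
    using that subspace_U(2)[OF assms] ker[OF assms(1)] assms(2) by auto
  ultimately show ?thesis
    using assms(2) lin[OF assms(1)] by (simp add: quot_part_def dim_inj_image)
qed

lemma fd_glue_U: "fd_space (U (Inl j0))"
  using subrep_fd_space[OF is_rep_M U] j_in_verts by (auto simp: verts_G)

lemma dim_glue_vertex: "cvec.dim (U (Inl j0)) = cvec.dim (sub_part U j0) + cvec.dim (quot_part U j1)"
  using subspace_U(1)[OF j_in_verts(1)] fd_glue_U
    dim_subspace_direct_sum[of "U (Inl j0)" "space X j0" "space Y j1"]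
  by (simp add: sub_part_def quot_part_def space_M)

lemma src_dim_split: "src_dim G U = src_dim Q0 (sub_part U) + src_dim Q1 (quot_part U)"
proof -
  have "(\<Sum>i\<in>sources Q0. cvec.dim (U (Inl i))) = src_dim Q0 (sub_part U)"
    unfolding src_dim_def using j_notin_sources by (intro sum.cong) (auto simp: sub_part_def)
  moreover have "(\<Sum>i\<in>sources Q1. cvec.dim (U (Inr i))) = src_dim Q1 (quot_part U)"
    unfolding src_dim_def using j_notin_sources bip1
    by (intro sum.cong refl dim_quot_part[symmetric]) (auto simp: bipartite_quiver_def)
  ultimately show ?thesis by (simp add: src_dim_G)
qed

lemma snk_dim_split: "snk_dim G U = snk_dim Q0 (sub_part U) + snk_dim Q1 (quot_part U)"
proof -
  have "(\<Sum>j\<in>sinks Q0 - {j0}. cvec.dim (U (Inl j))) = (\<Sum>j\<in>sinks Q0 - {j0}. cvec.dim (sub_part U j))"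
    by (intro sum.cong) (auto simp: sub_part_def)
  moreover have "(\<Sum>j\<in>sinks Q1 - {j1}. cvec.dim (U (Inr j))) =
      (\<Sum>j\<in>sinks Q1 - {j1}. cvec.dim (quot_part U j))"
    using bip1 by (intro sum.cong refl dim_quot_part[symmetric]) (auto simp: bipartite_quiver_def)
  moreover have "snk_dim Q0 (sub_part U) =
      cvec.dim (sub_part U j0) + (\<Sum>j\<in>sinks Q0 - {j0}. cvec.dim (sub_part U j))"
    using bipartite_quiver_finite[OF bip0] by (simp add: snk_dim_def sum.remove[OF _ j0])
  moreover have "snk_dim Q1 (quot_part U) =
      cvec.dim (quot_part U j1) + (\<Sum>j\<in>sinks Q1 - {j1}. cvec.dim (quot_part U j))"
    using bipartite_quiver_finite[OF bip1] by (simp add: snk_dim_def sum.remove[OF _ j1])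
  ultimately show ?thesis by (simp add: snk_dim_G dim_glue_vertex)
qed

lemma source_subspace_U: "source_subspace Q1 T (\<lambda>q. U (Inr q))"
  using subspace_U(2) bip1 j_notin_sources by (auto simp: source_subspace_def bipartite_quiver_def)

text \<open>
  At a sink \<open>j \<noteq> j1\<close> the images under \<open>T\<close> of the source spaces of \<open>U\<close> lie in \<open>U\<close>. At \<open>j1\<close> they do so
  after applying the injective map \<open>attach\<close>, which preserves dimensions.
\<close>

lemma image_dim_le: "image_dim Q1 T (\<lambda>q. U (Inr q)) \<le> snk_dim G U"
proof -
  define S where "S j = cvec.span (\<Union>a\<in>in_arcs (graph Q1) j. amap T a ` U (Inr (tail (graph Q1) a)))" for j
  have im: "(\<Union>a\<in>in_arcs (graph Q1) j. amap T a ` U (Inr (tail (graph Q1) a))) \<subseteq> space T j" for j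
  proof (clarsimp simp: in_arcs_def)
    fix a x assume a: "a \<in> arcs (graph Q1)" and x: "x \<in> U (Inr (tail (graph Q1) a))"
    note ends = bipartite_quiver_arcs[OF bip1 a]
    have "tail (graph Q1) a \<in> verts (graph Q1)" "tail (graph Q1) a \<noteq> j1"
      using ends bip1 j_notin_sources by (auto simp: bipartite_quiver_def)
    then have "x \<in> space T (tail (graph Q1) a)" using x subspace_U(2) by blast
    then show "amap T a x \<in> space T (head (graph Q1) a)" using T a by (auto simp: is_rep_def)
  qed
  have S_T: "S j \<subseteq> space T j" if "j \<in> verts (graph Q1)" for j
    unfolding S_def using im fd_space_imp_subspace[OF fd_T[OF that]] by (intro cvec.span_minimal) auto
  have S_U: "S j \<subseteq> U (Inr j)" if "j \<in> verts (graph Q1)" "j \<noteq> j1" for j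
    unfolding S_def
  proof (intro cvec.span_minimal)
    show "(\<Union>a\<in>in_arcs (graph Q1) j. amap T a ` U (Inr (tail (graph Q1) a))) \<subseteq> U (Inr j)"
      using amap_U(2) that(2) by (fastforce simp: in_arcs_def amap_M glue_vertex_def)
  qed (use subspace_U(2)[OF that] in simp)
  have "attach ` S j1 \<subseteq> U (Inl j0)"
  proof -
    have "S j1 \<subseteq> {t. attach t \<in> U (Inl j0)}"
      unfolding S_def
    proof (intro cvec.span_minimal)
      show "(\<Union>a\<in>in_arcs (graph Q1) j1. amap T a ` U (Inr (tail (graph Q1) a))) \<subseteq> {t. attach t \<in> U (Inl j0)}"
        using amap_U(2) by (fastforce simp: in_arcs_def amap_M glue_vertex_def)
      show "cvec.subspace {t. attach t \<in> U (Inl j0)}"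
      proof -
        interpret attach: Vector_Spaces.linear cscale cscale attach by (rule linear_attach)
        show ?thesis
          using subspace_U(1)[OF j_in_verts(1)]
          by (auto simp: cvec.subspace_def attach.add attach.scale attach.zero)
      qed
    qed
    then show ?thesis by blast
  qed
  then have "cvec.dim (attach ` S j1) \<le> cvec.dim (U (Inl j0))"
    using fd_glue_U by (rule dim_mono_fd_space)
  moreover have "cvec.dim (attach ` S j1) = cvec.dim (S j1)"
  proof (rule dim_inj_image[OF linear_attach])
    have "cvec.subspace (S j1)" unfolding S_def by (rule cvec.subspace_span)
    then show "fd_space (S j1)"
      using S_T[OF j_in_verts(2)] fd_T[OF j_in_verts(2)] by (rule fd_space_subset)
    show "t = 0" if "t \<in> S j1" "attach t = 0" for t
      using that attach_inj S_T[OF j_in_verts(2)] by blast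
  qed
  moreover have "(\<Sum>j\<in>sinks Q1 - {j1}. cvec.dim (S j)) \<le> (\<Sum>j\<in>sinks Q1 - {j1}. cvec.dim (U (Inr j)))"
  proof (intro sum_mono)
    fix j assume "j \<in> sinks Q1 - {j1}"
    then have j: "j \<in> verts (graph Q1)" "j \<noteq> j1" using bip1 by (auto simp: bipartite_quiver_def)
    then have "fd_space (U (Inr j))"
      using subrep_fd_space[OF is_rep_M U, of "Inr j"] by (auto simp: verts_G)
    then show "cvec.dim (S j) \<le> cvec.dim (U (Inr j))" using S_U[OF j] by (rule dim_mono_fd_space[rotated])
  qed
  moreover have "image_dim Q1 T (\<lambda>q. U (Inr q)) = cvec.dim (S j1) + (\<Sum>j\<in>sinks Q1 - {j1}. cvec.dim (S j))"
    using bipartite_quiver_finite[OF bip1] by (simp add: image_dim_def S_def sum.remove[OF _ j1])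
  ultimately show ?thesis by (simp add: snk_dim_G)
qed

end

end

section \<open>Stability of the glued representation\<close>

context glued_rep
begin

lemma dim_T:
  assumes "q \<in> verts (graph Q1)"
  shows "cvec.dim (space T q) = (if q = j1 then 1 else 0) + cvec.dim (space Y q)"
  using rank_nullity[OF lin[OF assms] fd_T[OF assms]] ker[OF assms] onto[OF assms] dim_L by simp

lemma dim_space_M_glue: "cvec.dim (space M (Inl j0)) = cvec.dim (space X j0) + cvec.dim (space Y j1)"
  using fd_X fd_Y j_in_verts by (simp add: space_M dim_direct_sum)

lemma has_dimv_M:
  assumes "has_dimv Q0 X" "has_dimv Q1 T"
  shows "has_dimv G M"
  unfolding has_dimv_def
proof
  fix q assume "q \<in> verts (graph G)"
  then consider "q = Inl j0" | p where "q = Inl p" "p \<noteq> j0" "p \<in> verts (graph Q0)"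
    | p where "q = Inr p" "p \<in> verts (graph Q1)"
    by (auto simp: verts_G)
  then show "cvec.dim (space M q) = dimv G q"
  proof cases
    case 1
    have "cvec.dim (space X j0) = dimv Q0 j0" "cvec.dim (space T j1) = dimv Q1 j1"
      using assms j_in_verts by (auto simp: has_dimv_def)
    then show ?thesis using 1 dim_space_M_glue dim_T[OF j_in_verts(2)] by simp
  qed (use assms in \<open>auto simp: has_dimv_def space_M\<close>)
qed

lemma src_dim_T: "src_dim Q1 (space T) = src_dim Q1 (space Y)"
  unfolding src_dim_def using j_notin_sources bip1
  by (intro sum.cong refl) (auto simp: dim_T bipartite_quiver_def)

lemma snk_dim_T: "snk_dim Q1 (space T) = Suc (snk_dim Q1 (space Y))"
proof -
  have "(\<Sum>j\<in>sinks Q1 - {j1}. cvec.dim (space T j)) = (\<Sum>j\<in>sinks Q1 - {j1}. cvec.dim (space Y j))"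
    using bip1 by (intro sum.cong refl) (auto simp: dim_T bipartite_quiver_def)
  then show ?thesis
    using bipartite_quiver_finite[OF bip1] dim_T[OF j_in_verts(2)]
    by (simp add: snk_dim_def sum.remove[OF _ j1])
qed

lemma src_dim_M: "src_dim G (space M) = src_dim Q0 (space X) + src_dim Q1 (space Y)"
proof -
  have "(\<Sum>i\<in>sources Q0. cvec.dim (space M (Inl i))) = src_dim Q0 (space X)"
    unfolding src_dim_def using j_notin_sources by (intro sum.cong) (auto simp: space_M)
  then show ?thesis by (simp add: src_dim_G space_M flip: src_dim_T) (simp add: src_dim_def)
qed

lemma snk_dim_M: "snk_dim G (space M) = snk_dim Q0 (space X) + snk_dim Q1 (space Y)"
proof -
  have "(\<Sum>j\<in>sinks Q0 - {j0}. cvec.dim (space M (Inl j))) = (\<Sum>j\<in>sinks Q0 - {j0}. cvec.dim (space X j))"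
    by (intro sum.cong) (auto simp: space_M)
  moreover have "(\<Sum>j\<in>sinks Q1 - {j1}. cvec.dim (space M (Inr j))) = (\<Sum>j\<in>sinks Q1 - {j1}. cvec.dim (space Y j))"
    using bip1 by (intro sum.cong refl) (auto simp: space_M dim_T bipartite_quiver_def)
  moreover have "snk_dim Q0 (space X) = cvec.dim (space X j0) + (\<Sum>j\<in>sinks Q0 - {j0}. cvec.dim (space X j))"
    using bipartite_quiver_finite[OF bip0] by (simp add: snk_dim_def sum.remove[OF _ j0])
  moreover have "snk_dim Q1 (space Y) = cvec.dim (space Y j1) + (\<Sum>j\<in>sinks Q1 - {j1}. cvec.dim (space Y j))"
    using bipartite_quiver_finite[OF bip1] by (simp add: snk_dim_def sum.remove[OF _ j1])
  ultimately show ?thesis by (simp add: snk_dim_G dim_space_M_glue)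
qed

text \<open>
  The hypothesis \<open>images\<close> is the condition on the numbers \<open>d\<^sub>U\<close>, cleared of denominators. It
  settles the subrepresentations that meet \<open>X\<close> trivially; the others inherit their inequality
  from the stability of \<open>X\<close> and the semistability of \<open>Y\<close>.
\<close>

lemma stable_M:
  assumes X_stable: "stable_rep Q0 X" and Y_semistable: "semistable_rep Q1 Y"
    and X_dims: "src_dim Q0 (space X) = d0" "snk_dim Q0 (space X) = e0"
    and Y_dims: "src_dim Q1 (space Y) = l * d" "snk_dim Q1 (space Y) = l * e"
    and pos: "0 < l" "0 < d"
    and det: "e0 * d = e * d0 + 1"
    and images: "\<And>U. source_subspace Q1 T U \<Longrightarrow> \<exists>i\<in>sources Q1. U i \<noteq> {0} \<Longrightarrow>
      (e0 + l * e) * (\<Sum>i\<in>sources Q1. cvec.dim (U i)) < (d0 + l * d) * image_dim Q1 T U"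
  shows "stable_rep G M"
  unfolding stable_rep_iff[OF bipartite_G]
proof (intro conjI allI impI is_rep_M; elim conjE)
  fix U assume U: "subrep G M U" and nonzero: "0 < src_dim G U + snk_dim G U"
    and proper: "src_dim G U + snk_dim G U < src_dim G (space M) + snk_dim G (space M)"
  define a b where "a = src_dim Q0 (sub_part U)" and "b = snk_dim Q0 (sub_part U)"
  define a'' b'' where "a'' = src_dim Q1 (quot_part U)" and "b'' = snk_dim Q1 (quot_part U)"
  have split: "src_dim G U = a + a''" "snk_dim G U = b + b''"
    using src_dim_split[OF U] snk_dim_split[OF U] by (simp_all add: a_def b_def a''_def b''_def)
  have M_dims: "src_dim G (space M) = d0 + l * d" "snk_dim G (space M) = e0 + l * e"
    by (simp_all add: src_dim_M snk_dim_M X_dims Y_dims)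
  have le: "a \<le> d0" "b \<le> e0" "a'' \<le> l * d"
    using subrep_dims_le[OF bip0 X subrep_sub_part[OF U]] subrep_dims_le[OF bip1 Y subrep_quot_part[OF U]]
    by (simp_all add: a_def b_def a''_def X_dims Y_dims)
  have "a'' * (l * e) \<le> (l * d) * b''"
    using semistable_rep_imp[OF bip1 Y_semistable subrep_quot_part[OF U]]
    by (simp add: a''_def b''_def Y_dims)
  then have "l * (a'' * e) \<le> l * (d * b'')" by (simp add: ac_simps)
  then have quot: "a'' * e \<le> d * b''" using pos by simp
  consider (zero) "a + b = 0" | (full) "a = d0" "b = e0" | (mid) "0 < a + b" "a + b < d0 + e0"
    using le by linarith
  then have "(a + a'') * (e0 + l * e) < (d0 + l * d) * (b + b'')"
  proof cases
    case zero
    show ?thesis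
    proof (cases "\<exists>i\<in>sources Q1. U (Inr i) \<noteq> {0}")
      case True
      have "(\<Sum>i\<in>sources Q0. cvec.dim (U (Inl i))) = a"
        unfolding a_def src_dim_def using j_notin_sources by (intro sum.cong) (auto simp: sub_part_def)
      then have "(\<Sum>i\<in>sources Q1. cvec.dim (U (Inr i))) = a + a''"
        using zero split src_dim_G[of U] by simp
      then have "(a + a'') * (e0 + l * e) < (d0 + l * d) * image_dim Q1 T (\<lambda>q. U (Inr q))"
        using images[OF source_subspace_U[OF U] True] by (simp add: mult.commute)
      also have "\<dots> \<le> (d0 + l * d) * (b + b'')"
        using image_dim_le[OF U] split by simp
      finally show ?thesis .
    next
      case False
      have "cvec.dim (quot_part U i) = 0" if i: "i \<in> sources Q1" for i
      proof -
        have "i \<in> verts (graph Q1)" "i \<noteq> j1" using i bip1 j_notin_sources by (auto simp: bipartite_quiver_def)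
        then show ?thesis using dim_quot_part[OF U] False i by simp
      qed
      then have "a'' = 0" by (simp add: a''_def src_dim_def)
      \<comment> \<open>\<open>U\<close> is concentrated in the sinks and has slope \<open>0\<close>.\<close>
      moreover have "0 < b''" using nonzero split zero \<open>a'' = 0\<close> by simp
      ultimately show ?thesis using zero pos by simp
    qed
  next
    case full
    then have "a'' + b'' < l * d + l * e" using proper split M_dims by simp
    then show ?thesis using slope_inequality_full[OF det le(3) quot _ pos(2)] full by simp
  next
    case mid
    then have "a * e0 < d0 * b"
      using X_stable subrep_sub_part[OF U] unfolding stable_rep_iff[OF bip0] X_dims
      by (auto simp: a_def b_def)
    then show ?thesis by (rule slope_inequality_proper[OF det le(3) quot _ pos(2)])
  qed
  then show "src_dim G U * snk_dim G (space M) < src_dim G (space M) * snk_dim G U"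
    by (simp only: split M_dims)
qed

end

text \<open>
  This provides the linear form that identifies the line \<open>L\<close> with a line in another space.
\<close>

lemma line_coordinate:
  assumes "cvec.subspace L" "fd_space L" "cvec.dim L = 1"
  obtains n where "\<And>x. x \<in> L \<Longrightarrow> x n = 0 \<Longrightarrow> x = 0"
proof -
  have "L \<noteq> {0}" using assms(3) by auto
  then obtain v where v: "v \<in> L" "v \<noteq> 0" using cvec.subspace_0[OF assms(1)] by auto
  have "cvec.span {v} \<subseteq> L" using v assms(1) by (simp add: cvec.span_minimal)
  moreover have "cvec.dim (cvec.span {v}) = 1"
    using v by (simp add: cvec.dim_eq_card_independent)
  ultimately have "L = cvec.span {v}" using subspace_eq_of_dim_eq[of "cvec.span {v}" L] assms by simp
  moreover obtain n where "v n \<noteq> 0" using v(2) by (auto simp: fun_eq_iff)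
  ultimately have "x = 0" if "x \<in> L" "x n = 0" for x
    using that by (auto simp: cvec.span_singleton cscale_def fun_eq_iff)
  then show ?thesis using that by blast
qed

text \<open>
  The factor \<open>Y\<close> is semistable as a representation of the quiver with lowered dimension at \<open>j1\<close>,
  but the dimension vector of the quiver does not enter semistability, whose slopes are computed
  from the spaces.
\<close>

lemma semistable_rep_dimv_update [simp]: "semistable_rep (Q\<lparr>dimv := f\<rparr>) = semistable_rep Q"
  by (simp add: fun_eq_iff semistable_rep_def is_rep_def proper_nonzero_subrep_def subrep_def slope_def)

theorem theorem4p18:
  fixes m d e ds es k l :: nat
    and T0 :: "('v0, 'a0) bip_quiver" and j0 :: 'v0
    and T1 :: "('v1, 'a1) bip_quiver" and j1 :: 'v1
  assumes "m \<ge> 1"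
    and "0 < d" and "d \<le> e" and "coprime d e"
    and "starting_vector d e ds es"
    and "l \<ge> 1"
    and "T0 \<in> stable_quivers m (ds + k * d) (es + k * e)"
    and "(T1, j1) \<in> glueable_pairs m d e ds es k l"
    and "j0 \<in> sinks T0" and "dimv T0 j0 \<ge> 1"
    and "card (nbrs T0 j0) + card (nbrs T1 j1) \<le> m"
  shows "glue_quiver T0 j0 T1 j1 \<in> stable_quivers m (ds + (k + l) * d) (es + (k + l) * e)"
proof -
  define d0 e0 where "d0 = ds + k * d" and "e0 = es + k * e"
  have D: "(k + l) * d + ds = d0 + l * d" "(k + l) * e + es = e0 + l * e"
    by (simp_all add: d0_def e0_def algebra_simps)
  have "es * d = e * ds + 1" using starting_vector_det assms(2,4,5) by blast
  then have det: "e0 * d = e * d0 + 1" by (simp add: d0_def e0_def algebra_simps)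
  have m0: "m_bipartite m T0" and type0: "dim_type T0 = (d0, e0)"
    using assms(7) by (simp_all add: stable_quivers_def d0_def e0_def)
  obtain X where rep_X: "is_rep T0 X" and dimv_X: "has_dimv T0 X" and stable_X: "stable_rep T0 X"
    using assms(7) by (auto simp: stable_quivers_def)
  obtain T L Y where m1: "m_bipartite m T1" and type1: "dim_type T1 = (l * d, l * e + 1)"
    and sink_j1: "j1 \<in> sinks T1" "1 \<le> dimv T1 j1"
    and rep_T: "is_rep T1 T" and dimv_T: "has_dimv T1 T"
    and images: "\<forall>U. source_subspace T1 T U \<and> (\<exists>i\<in>sources T1. U i \<noteq> {0}) \<longrightarrow>
      real ((k + l) * e + es) / real ((k + l) * d + ds) * real (\<Sum>i\<in>sources T1. cvec.dim (U i))
        < real (image_dim T1 T U)"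
    and L: "cvec.subspace L" "L \<subseteq> space T j1" "cvec.dim L = 1"
    and fac: "factor_rep T1 T ((\<lambda>_. {0})(j1 := L)) Y" and semistable_Y: "semistable_rep T1 Y"
    using assms(8)
    unfolding glueable_pairs_def mem_Collect_eq case_prod_conv semistable_rep_dimv_update
    by (elim conjE exE) (rule that; assumption)
  obtain \<phi> where
    \<phi>: "\<forall>q\<in>verts (graph T1). Vector_Spaces.linear cscale cscale (\<phi> q) \<and>
      \<phi> q ` space T q = space Y q \<and> {x \<in> space T q. \<phi> q x = 0} = ((\<lambda>_. {0})(j1 := L)) q"
    and comm: "\<forall>a\<in>arcs (graph T1). \<forall>x\<in>space T (tail (graph T1) a).
      \<phi> (head (graph T1) a) (amap T a x) = amap Y a (\<phi> (tail (graph T1) a) x)"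
    and rep_Y: "is_rep T1 Y"
    using fac unfolding factor_rep_def by (elim conjE exE) (rule that; assumption)
  have bip: "bipartite_quiver T0" "bipartite_quiver T1"
    using m0 m1 by (simp_all add: m_bipartite_def)
  interpret glueing T0 j0 T1 j1
    using bip assms(9) sink_j1 by unfold_locales
  have "fd_space (space T j1)" using rep_T j_in_verts by (simp add: is_rep_def)
  then have "fd_space L" by (rule fd_space_subset[OF L(1,2)])
  then obtain n where n: "\<And>x. x \<in> L \<Longrightarrow> x n = 0 \<Longrightarrow> x = 0"
    using line_coordinate[OF L(1) _ L(3)] by blast
  have "cvec.dim (space X j0) \<noteq> 0" using dimv_X j_in_verts assms(10) by (simp add: has_dimv_def)
  then obtain u where u: "u \<in> space X j0" "u \<noteq> 0"
    using rep_X j_in_verts(1) dim_zero_iff[of "space X j0"] fd_space_imp_subspace[THEN cvec.subspace_0]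
    by (auto simp: is_rep_def)
  interpret glued_rep T0 j0 T1 j1 X T Y \<phi> L u n
  proof (intro glued_rep.intro glueing_axioms glued_rep_axioms.intro)
    show "x = 0" if "x \<in> L" "x n = 0" for x using that by (rule n)
    show "Vector_Spaces.linear cscale cscale (\<phi> q)" if "q \<in> verts (graph T1)" for q
      using \<phi> that by blast
  qed (use rep_X rep_T rep_Y u \<phi> comm L(3) in auto)
  have X_dims: "src_dim T0 (space X) = d0" "snk_dim T0 (space X) = e0"
    using dim_type_of_rep[OF bip(1) dimv_X] type0 by simp_all
  have Y_dims: "src_dim T1 (space Y) = l * d" "snk_dim T1 (space Y) = l * e"
    using dim_type_of_rep[OF bip(2) dimv_T] type1 src_dim_T snk_dim_T by simp_all
  have "stable_rep G M"
  proof (rule stable_M[OF stable_X semistable_Y X_dims Y_dims _ assms(2) det])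
    fix U assume "source_subspace T1 T U" "\<exists>i\<in>sources T1. U i \<noteq> {0}"
    then have "real (e0 + l * e) / real (d0 + l * d) * real (\<Sum>i\<in>sources T1. cvec.dim (U i))
        < real (image_dim T1 T U)"
      using images[THEN spec, of U] unfolding D by blast
    moreover have "0 < real (d0 + l * d)"
      using assms(2,6) unfolding of_nat_0_less_iff by simp
    ultimately have "real (e0 + l * e) * real (\<Sum>i\<in>sources T1. cvec.dim (U i))
        < real (image_dim T1 T U) * real (d0 + l * d)"
      by (simp only: times_divide_eq_left pos_divide_less_eq)
    then have "real ((e0 + l * e) * (\<Sum>i\<in>sources T1. cvec.dim (U i))) < real ((d0 + l * d) * image_dim T1 T U)"
      by (simp only: of_nat_mult mult.commute)
    then show "(e0 + l * e) * (\<Sum>i\<in>sources T1. cvec.dim (U i)) < (d0 + l * d) * image_dim T1 T U"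
      by (simp only: of_nat_less_iff)
  qed (use assms(6) in simp)
  moreover have "m_bipartite m G"
    by (rule m_bipartite_G[OF m0 m1 assms(10) sink_j1(2) assms(11)])
  moreover have has_dimv: "has_dimv G M" using dimv_X dimv_T by (rule has_dimv_M)
  moreover have "dim_type G = (ds + (k + l) * d, es + (k + l) * e)"
    unfolding dim_type_of_rep[OF bipartite_G has_dimv] src_dim_M snk_dim_M X_dims Y_dims
    by (simp add: d0_def e0_def algebra_simps)
  ultimately show ?thesis
    unfolding stable_quivers_def using is_rep_M by blast
qed

end
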